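(* Let $q$ be a prime power (a power of an odd prime in part (3)). With the transition matrices $P_{\mathrm{sym}},P_{\mathrm{alt}},Q_{\mathrm{alt}},P_{\mathrm{Her}}$ and distributions $\pi_{\mathrm{sym}},\pi_{\mathrm{alt}},\pi'_{\mathrm{alt}},\pi_{\mathrm{Her}}$ on $\mathbb{Z}_{\ge0}$ defined in the context: (1) $P_{\mathrm{sym}}$ is compact on $\ell^2(\pi_{\mathrm{sym}})$, with set of eigenvalues $\{\pm q^{-k}:k\ge0\}\setminus\{-1\}$. (2) $P_{\mathrm{alt}}$ (resp. $Q_{\mathrm{alt}}$) is compact on $\ell^2(\pi_{\mathrm{alt}})$ (resp. $\ell^2(\pi'_{\mathrm{alt}})$), with set of eigenvalues $\{q^{-2k}:k\ge0\}$. (3) $P_{\mathrm{Her}}$ is compact on $\ell^2(\pi_{\mathrm{Her}})$, with set of eigenvalues $\{(-q)^{-k}:k\ge0\}$.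
   Context: Notation: $\eta_k(x)=\prod_{j=1}^k(1-x^{-j})$; $\alpha(q)=\prod_{i\ge1,\ i\text{ odd}}(1-q^{-i})$; $\beta(q)=\prod_{i\ge1,\ i\text{ odd}}(1+q^{-i})^{-1}$. All matrices below are transition matrices on $\mathbb{Z}_{\ge0}$; unlisted entries are $0$, and the entries $(i,i-1)$ are for $i\ge1$. Each is irreducible, aperiodic, and reversible with respect to the stated stationary distribution. They govern coranks of uniformly random symmetric, alternating (odd size: $P_{\mathrm{alt}}$; even size: $Q_{\mathrm{alt}}$) and Hermitian matrices over finite fields. $P_{\mathrm{sym}}(i,i+1)=q^{-i-1}$, $P_{\mathrm{sym}}(i,i)=q^{-i}-q^{-i-1}$, $P_{\mathrm{sym}}(i,i-1)=1-q^{-i}$; $\pi_{\mathrm{sym}}(k)=\alpha(q)/\prod_{i=1}^k(q^i-1)$. $P_{\mathrm{alt}}(i,i+1)=q^{-4i-3}$, $P_{\mathrm{alt}}(i,i)=1-q^{-4i-3}-(1-q^{-2i})(1-q^{-2i-1})$, $P_{\mathrm{alt}}(i,i-1)=(1-q^{-2i})(1-q^{-2i-1})$; $\pi_{\mathrm{alt}}(j)=\alpha(q)/(q^{2j^2+j}\eta_{2j+1}(q))$. $Q_{\mathrm{alt}}(i,i+1)=q^{-4i-1}$, $Q_{\mathrm{alt}}(i,i)=1-q^{-4i-1}-(1-q^{-2i})(1-q^{-2i+1})$, $Q_{\mathrm{alt}}(i,i-1)=(1-q^{-2i})(1-q^{-2i+1})$; $\pi'_{\mathrm{alt}}(j)=\alpha(q)/(q^{2j^2-j}\eta_{2j}(q))$.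 $P_{\mathrm{Her}}(i,i+1)=q^{-2i-1}$, $P_{\mathrm{Her}}(i,i)=q^{-2i}(1-q^{-1})$, $P_{\mathrm{Her}}(i,i-1)=1-q^{-2i}$; $\pi_{\mathrm{Her}}(j)=\beta(q)/(q^{j^2}\eta_j(q^2))$. For a strictly positive probability distribution $\pi$ on $\mathbb{Z}_{\ge0}$, $\ell^2(\pi)$ is the Hilbert space of complex sequences $\mu$ with $\sum_i|\mu(i)|^2/\pi(i)<\infty$, with inner product $\langle\mu,\nu\rangle_\pi=\sum_i\mu(i)\overline{\nu(i)}/\pi(i)$. A transition matrix $P$ reversible with respect to $\pi$ acts on $\ell^2(\pi)$ as a bounded self-adjoint operator by $\mu\mapsto\mu P$, $(\mu P)(j)=\sum_i\mu(i)P(i,j)$. *)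

theory Defs
  imports "HOL-Analysis.Analysis" "HOL-Number_Theory.Prime_Powers"
begin

definition eta :: "nat \<Rightarrow> real \<Rightarrow> real" where
  "eta k x = (\<Prod>j=1..k. 1 - x powi (- int j))"

text \<open>In \<open>alpha\<close> and \<open>beta\<close> the odd indices are enumerated as \<open>2 * n + 1\<close>.\<close>

definition alpha :: "real \<Rightarrow> real" where
  "alpha q = prodinf (\<lambda>n. 1 - q powi (- (2 * int n + 1)))"

definition beta :: "real \<Rightarrow> real" where
  "beta q = prodinf (\<lambda>n. inverse (1 + q powi (- (2 * int n + 1))))"

definition P_sym :: "real \<Rightarrow> nat \<Rightarrow> nat \<Rightarrow> real" where
  "P_sym q i j =
     (if j = i + 1 then q powi (- int i - 1)
      else if j = i then q powi (- int i) - q powi (- int i - 1)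
      else if i = j + 1 then 1 - q powi (- int i)
      else 0)"

definition pi_sym :: "real \<Rightarrow> nat \<Rightarrow> real" where
  "pi_sym q k = alpha q / (\<Prod>i=1..k. q ^ i - 1)"

definition P_alt :: "real \<Rightarrow> nat \<Rightarrow> nat \<Rightarrow> real" where
  "P_alt q i j =
     (if j = i + 1 then q powi (- 4 * int i - 3)
      else if j = i then
        1 - q powi (- 4 * int i - 3) - (1 - q powi (- 2 * int i)) * (1 - q powi (- 2 * int i - 1))
      else if i = j + 1 then (1 - q powi (- 2 * int i)) * (1 - q powi (- 2 * int i - 1))
      else 0)"

definition pi_alt :: "real \<Rightarrow> nat \<Rightarrow> real" where
  "pi_alt q j = alpha q / (q ^ (2 * j\<^sup>2 + j) * eta (2 * j + 1) q)"

definition Q_alt :: "real \<Rightarrow> nat \<Rightarrow> nat \<Rightarrow> real" where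
  "Q_alt q i j =
     (if j = i + 1 then q powi (- 4 * int i - 1)
      else if j = i then
        1 - q powi (- 4 * int i - 1) - (1 - q powi (- 2 * int i)) * (1 - q powi (- 2 * int i + 1))
      else if i = j + 1 then (1 - q powi (- 2 * int i)) * (1 - q powi (- 2 * int i + 1))
      else 0)"

definition pi'_alt :: "real \<Rightarrow> nat \<Rightarrow> real" where
  "pi'_alt q j = alpha q / (q powi (2 * (int j)\<^sup>2 - int j) * eta (2 * j) q)"

definition P_Her :: "real \<Rightarrow> nat \<Rightarrow> nat \<Rightarrow> real" where
  "P_Her q i j =
     (if j = i + 1 then q powi (- 2 * int i - 1)
      else if j = i then q powi (- 2 * int i) * (1 - q powi (- 1))
      else if i = j + 1 then 1 - q powi (- 2 * int i)
      else 0)"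

definition pi_Her :: "real \<Rightarrow> nat \<Rightarrow> real" where
  "pi_Her q j = beta q / (q ^ (j\<^sup>2) * eta j (q\<^sup>2))"

definition l2 :: "(nat \<Rightarrow> real) \<Rightarrow> (nat \<Rightarrow> complex) set" where
  "l2 \<pi> = {\<mu>. (\<lambda>i. (cmod (\<mu> i))\<^sup>2 / \<pi> i) summable_on UNIV}"

definition l2_inner :: "(nat \<Rightarrow> real) \<Rightarrow> (nat \<Rightarrow> complex) \<Rightarrow> (nat \<Rightarrow> complex) \<Rightarrow> complex" where
  "l2_inner \<pi> \<mu> \<nu> = (\<Sum>\<^sub>\<infinity>i. \<mu> i * cnj (\<nu> i) / complex_of_real (\<pi> i))"

definition l2_norm :: "(nat \<Rightarrow> real) \<Rightarrow> (nat \<Rightarrow> complex) \<Rightarrow> real" where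
  "l2_norm \<pi> \<mu> = sqrt (Re (l2_inner \<pi> \<mu> \<mu>))"

definition l2_dist :: "(nat \<Rightarrow> real) \<Rightarrow> (nat \<Rightarrow> complex) \<Rightarrow> (nat \<Rightarrow> complex) \<Rightarrow> real" where
  "l2_dist \<pi> \<mu> \<nu> = l2_norm \<pi> (\<lambda>i. \<mu> i - \<nu> i)"

text \<open>\<open>right_mult P \<mu>\<close> is the row vector \<open>\<mu> P\<close>. For the tridiagonal matrices above the sum has
  at most three nonzero terms, so it is defined for every sequence \<open>\<mu>\<close>.\<close>

definition right_mult :: "(nat \<Rightarrow> nat \<Rightarrow> real) \<Rightarrow> (nat \<Rightarrow> complex) \<Rightarrow> nat \<Rightarrow> complex" where
  "right_mult P \<mu> j = (\<Sum>\<^sub>\<infinity>i. \<mu> i * complex_of_real (P i j))"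

text \<open>A compact operator is a linear map of \<open>l2 \<pi>\<close> into itself taking bounded sets to relatively
  compact sets. The constants \<open>Metric_space.mbounded\<close> and \<open>Metric_space.mtopology\<close> are meaningful
  by lemma \<open>Metric_space_l2\<close> below.\<close>

definition compact_operator_on_l2 ::
    "(nat \<Rightarrow> real) \<Rightarrow> ((nat \<Rightarrow> complex) \<Rightarrow> (nat \<Rightarrow> complex)) \<Rightarrow> bool" where
  "compact_operator_on_l2 \<pi> T \<longleftrightarrow>
     T ` l2 \<pi> \<subseteq> l2 \<pi> \<and>
     (\<forall>\<mu>\<in>l2 \<pi>. \<forall>\<nu>\<in>l2 \<pi>. T (\<lambda>i. \<mu> i + \<nu> i) = (\<lambda>i. T \<mu> i + T \<nu> i)) \<and>
     (\<forall>c. \<forall>\<mu>\<in>l2 \<pi>. T (\<lambda>i. c * \<mu> i) = (\<lambda>i. c * T \<mu> i)) \<and>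
     (\<forall>B. Metric_space.mbounded (l2 \<pi>) (l2_dist \<pi>) B \<longrightarrow>
        compactin (Metric_space.mtopology (l2 \<pi>) (l2_dist \<pi>))
          (Metric_space.mtopology (l2 \<pi>) (l2_dist \<pi>) closure_of (T ` B)))"

definition eigenvalues_on_l2 ::
    "(nat \<Rightarrow> real) \<Rightarrow> ((nat \<Rightarrow> complex) \<Rightarrow> (nat \<Rightarrow> complex)) \<Rightarrow> complex set" where
  "eigenvalues_on_l2 \<pi> T =
     {c. \<exists>\<mu>\<in>l2 \<pi>. \<mu> \<noteq> (\<lambda>i. 0) \<and> T \<mu> = (\<lambda>i. c * \<mu> i)}"

lemma l2_inner_self: "l2_inner \<pi> \<mu> \<mu> = complex_of_real (\<Sum>\<^sub>\<infinity>i. (cmod (\<mu> i))\<^sup>2 / \<pi> i)"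
proof -
  have "(\<lambda>i. \<mu> i * cnj (\<mu> i) / complex_of_real (\<pi> i))
      = (\<lambda>i. complex_of_real ((cmod (\<mu> i))\<^sup>2 / \<pi> i))"
    by (simp only: of_real_divide complex_norm_square)
  moreover have "(\<Sum>\<^sub>\<infinity>i. complex_of_real (f i)) = complex_of_real (\<Sum>\<^sub>\<infinity>i. f i)"
    for f :: "nat \<Rightarrow> real"
  proof (cases "f summable_on UNIV")
    case True
    then show ?thesis
      by (intro infsumI has_sum_of_real has_sum_infsum)
  next
    case False
    then have "\<not> (\<lambda>i. complex_of_real (f i)) summable_on UNIV"
      using summable_on_Re[of "\<lambda>i. complex_of_real (f i)" UNIV] by auto
    with False show ?thesis
      by (simp add: infsum_not_exists)
  qed
  ultimately show ?thesis
    unfolding l2_inner_def by (simp only:)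
qed

lemma l2_norm_altdef: "l2_norm \<pi> \<mu> = sqrt (\<Sum>\<^sub>\<infinity>i. (cmod (\<mu> i))\<^sup>2 / \<pi> i)"
  by (simp add: l2_norm_def l2_inner_self)

lemma
  assumes pos: "\<And>i. \<pi> i > 0" and mem: "\<mu> \<in> l2 \<pi>" "\<nu> \<in> l2 \<pi>"
  shows l2_add: "(\<lambda>i. \<mu> i + \<nu> i) \<in> l2 \<pi>"
    and l2_norm_triangle: "l2_norm \<pi> (\<lambda>i. \<mu> i + \<nu> i) \<le> l2_norm \<pi> \<mu> + l2_norm \<pi> \<nu>"
proof -
  define N where "N = l2_norm \<pi> \<mu> + l2_norm \<pi> \<nu>"
  define w where "w = (\<lambda>(\<mu>::nat \<Rightarrow> complex) i. cmod (\<mu> i) / sqrt (\<pi> i))"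
  have sq: "(w \<mu> i)\<^sup>2 = (cmod (\<mu> i))\<^sup>2 / \<pi> i" for \<mu> i
    using pos[of i] by (simp add: w_def power_divide)
  have part: "L2_set (w \<rho>) F \<le> l2_norm \<pi> \<rho>" if "\<rho> \<in> l2 \<pi>" "finite F" for \<rho> F
    unfolding L2_set_def l2_norm_altdef sq
    using that pos by (intro real_sqrt_le_mono finite_sum_le_infsum)
      (auto simp: l2_def less_imp_le)
  have bound: "(\<Sum>i\<in>F. (cmod (\<mu> i + \<nu> i))\<^sup>2 / \<pi> i) \<le> N\<^sup>2" if "finite F" for F
  proof -
    have "L2_set (w (\<lambda>i. \<mu> i + \<nu> i)) F \<le> L2_set (\<lambda>i. w \<mu> i + w \<nu> i) F"
      using pos by (intro L2_set_mono)
        (auto simp: w_def add_divide_distrib[symmetric] norm_triangle_ineq less_imp_le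
              intro!: divide_right_mono)
    also have "\<dots> \<le> L2_set (w \<mu>) F + L2_set (w \<nu>) F"
      by (rule L2_set_triangle_ineq)
    also have "\<dots> \<le> N"
      unfolding N_def using part mem that by (intro add_mono) auto
    finally have "(L2_set (w (\<lambda>i. \<mu> i + \<nu> i)) F)\<^sup>2 \<le> N\<^sup>2"
      by (intro power_mono L2_set_nonneg)
    then show ?thesis
      by (simp add: L2_set_def sq sum_nonneg less_imp_le[OF pos])
  qed
  have summ: "(\<lambda>i. (cmod (\<mu> i + \<nu> i))\<^sup>2 / \<pi> i) summable_on UNIV"
    using bound pos by (intro nonneg_bdd_above_summable_on bdd_aboveI[of _ "N\<^sup>2"])
      (auto simp: less_imp_le)
  then show "(\<lambda>i. \<mu> i + \<nu> i) \<in> l2 \<pi>"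
    by (simp add: l2_def)
  have "0 \<le> N"
    using part[OF mem(1), of "{}"] part[OF mem(2), of "{}"] by (simp add: N_def)
  moreover have "(\<Sum>\<^sub>\<infinity>i. (cmod (\<mu> i + \<nu> i))\<^sup>2 / \<pi> i) \<le> N\<^sup>2"
    using summ bound by (intro infsum_le_finite_sums)
  ultimately show "l2_norm \<pi> (\<lambda>i. \<mu> i + \<nu> i) \<le> l2_norm \<pi> \<mu> + l2_norm \<pi> \<nu>"
    unfolding N_def[symmetric] l2_norm_altdef[of \<pi> "\<lambda>i. \<mu> i + \<nu> i"]
    by (intro real_le_lsqrt)
qed

lemma l2_minus: "\<mu> \<in> l2 \<pi> \<Longrightarrow> (\<lambda>i. - \<mu> i) \<in> l2 \<pi>"
  by (simp add: l2_def)

lemma l2_diff: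
  assumes "\<And>i. \<pi> i > 0" "\<mu> \<in> l2 \<pi>" "\<nu> \<in> l2 \<pi>"
  shows "(\<lambda>i. \<mu> i - \<nu> i) \<in> l2 \<pi>"
  using l2_add[OF assms(1,2) l2_minus[OF assms(3)]] by simp

lemma Metric_space_l2:
  assumes pos: "\<And>i. \<pi> i > 0"
  shows "Metric_space (l2 \<pi>) (l2_dist \<pi>)"
proof
  fix \<mu> \<nu> :: "nat \<Rightarrow> complex"
  show "0 \<le> l2_dist \<pi> \<mu> \<nu>"
    using pos by (auto simp: l2_dist_def l2_norm_altdef less_imp_le intro!: infsum_nonneg)
  show "l2_dist \<pi> \<mu> \<nu> = l2_dist \<pi> \<nu> \<mu>"
    by (simp add: l2_dist_def l2_norm_altdef norm_minus_commute)
next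
  fix \<mu> \<nu> assume mem: "\<mu> \<in> l2 \<pi>" "\<nu> \<in> l2 \<pi>"
  show "l2_dist \<pi> \<mu> \<nu> = 0 \<longleftrightarrow> \<mu> = \<nu>"
  proof
    assume "l2_dist \<pi> \<mu> \<nu> = 0"
    then have 0: "(\<Sum>\<^sub>\<infinity>i. (cmod (\<mu> i - \<nu> i))\<^sup>2 / \<pi> i) = 0"
      by (simp add: l2_dist_def l2_norm_altdef)
    have "(cmod (\<mu> i - \<nu> i))\<^sup>2 / \<pi> i = 0" for i
      using l2_diff[OF pos mem] pos 0
      by (intro nonneg_infsum_le_0D[where A = UNIV]) (auto simp: l2_def less_imp_le)
    moreover have "\<pi> i \<noteq> 0" for i
      using pos[of i] by simp
    ultimately show "\<mu> = \<nu>"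
      by (auto simp: fun_eq_iff)
  qed (simp add: l2_dist_def l2_norm_altdef)
next
  fix \<mu> \<nu> \<rho> assume "\<mu> \<in> l2 \<pi>" "\<nu> \<in> l2 \<pi>" "\<rho> \<in> l2 \<pi>"
  then have "(\<lambda>i. \<mu> i - \<nu> i) \<in> l2 \<pi>" "(\<lambda>i. \<nu> i - \<rho> i) \<in> l2 \<pi>"
    using l2_diff[OF pos] by auto
  from l2_norm_triangle[OF pos this]
  show "l2_dist \<pi> \<mu> \<rho> \<le> l2_dist \<pi> \<mu> \<nu> + l2_dist \<pi> \<nu> \<rho>"
    by (simp add: l2_dist_def)
qed

lemma summable_odd_powi:
  assumes "q > (1::real)"
  shows "summable (\<lambda>n. q powi (- (2 * int n + 1)))"
proof -
  have "q powi (- (2 * int n + 1)) = inverse q * (inverse (q\<^sup>2)) ^ n" for n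
  proof -
    have "2 * int n + 1 = int (2 * n + 1)"
      by simp
    then have "q powi (- (2 * int n + 1)) = inverse (q ^ (2 * n + 1))"
      by (simp only: power_int_minus power_int_of_nat)
    then show ?thesis
      by (simp add: power_mult power_inverse)
  qed
  moreover have "summable (\<lambda>n. inverse q * (inverse (q\<^sup>2)) ^ n)"
  proof (intro summable_mult summable_geometric)
    have "1 < q\<^sup>2"
      using assms by (simp add: one_less_power)
    then show "norm (inverse (q\<^sup>2)) < 1"
      by (simp add: inverse_less_1_iff)
  qed
  ultimately show ?thesis
    by simp
qed

lemma alpha_pos:
  assumes "q > 1"
  shows "alpha q > 0"
proof -
  have "convergent_prod (\<lambda>n. 1 - q powi (- (2 * int n + 1)))"
    using assms summable_odd_powi[OF assms]
    by (intro abs_convergent_prod_imp_convergent_prod summable_imp_abs_convergent_prod) auto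
  moreover have "q powi (- (2 * int n + 1)) < 1" for n
    using assms power_int_strict_increasing[of "- (2 * int n + 1)" 0 q] by simp
  ultimately show ?thesis
    unfolding alpha_def by (intro less_0_prodinf) auto
qed

lemma beta_pos:
  assumes "q > 1"
  shows "beta q > 0"
proof -
  have "convergent_prod (\<lambda>n. 1 + q powi (- (2 * int n + 1)))"
    using assms summable_odd_powi[OF assms]
    by (intro abs_convergent_prod_imp_convergent_prod summable_imp_abs_convergent_prod) auto
  then have "convergent_prod (\<lambda>n. inverse (1 + q powi (- (2 * int n + 1))))"
    by (rule convergent_prod_inverse)
  then show ?thesis
    unfolding beta_def using assms by (intro less_0_prodinf) (simp_all add: add_pos_pos)
qed

lemma eta_pos:
  assumes "x > 1"
  shows "eta k x > 0"
  unfolding eta_def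
proof (rule prod_pos)
  fix j assume "j \<in> {1..k}"
  then show "0 < 1 - x powi (- int j)"
    using assms power_int_strict_increasing[of "- int j" 0 x] by simp
qed

lemma
  assumes "q > 1"
  shows pi_sym_pos: "pi_sym q k > 0"
    and pi_alt_pos: "pi_alt q k > 0"
    and pi'_alt_pos: "pi'_alt q k > 0"
    and pi_Her_pos: "pi_Her q k > 0"
  using assms alpha_pos[OF assms] beta_pos[OF assms] eta_pos[OF assms] eta_pos[of "q\<^sup>2"]
  unfolding pi_sym_def pi_alt_def pi'_alt_def pi_Her_def
  by (auto simp: zero_less_divide_iff zero_less_mult_iff one_less_power intro!: prod_pos)

end

theory Submission
  imports Defs
begin

text \<open>
  A reversible tridiagonal matrix whose diagonal entries and products \<open>P(i,i+1) P(i+1,i)\<close> tend to \<open>0\<close>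
  satisfies \<open>\<parallel>\<mu>P\<parallel>\<^sup>2 \<le> \<Sum>\<^sub>i \<kappa>\<^sub>i |\<mu>\<^sub>i|\<^sup>2 / \<pi>\<^sub>i\<close> with \<open>\<kappa>\<^sub>i \<rightarrow> 0\<close>; since bounded sequences
  in \<open>l2 \<pi>\<close> have pointwise convergent subsequences, the operator is compact.

  Put \<open>x = 1/q\<close>. For the eigenvalue problem \<open>\<mu>P = c\<mu>\<close>, consider the generating function
  \<open>F(z) = \<Sum> \<mu>\<^sub>i z\<^sup>i\<close>, which is entire when \<open>\<mu> \<in> l2 \<pi>\<close>. For the symmetric (\<open>p = x\<close>) and
  Hermitian (\<open>p = x\<^sup>2\<close>) chains the equation becomes \<open>(1 - cz) F(z) = (1 - z) (1 + xz) F(pz)\<close>.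
  If \<open>c \<noteq> 0\<close> is none of \<open>p\<^sup>k\<close>, \<open>-x p\<^sup>k\<close>, evaluation at \<open>z = p\<^sup>n/c\<close> shows successively that
  \<open>F(p\<^sup>n/c) = 0\<close> for all \<open>n \<ge> 1\<close>, so \<open>F(0) = 0\<close> and \<open>\<mu> = 0\<close>. Conversely \<open>F \<mapsto> (1 - cz) F\<close> raises
  an eigenvector for \<open>c\<close> to one for \<open>pc\<close>, starting from \<open>\<pi>\<close> (\<open>c = 1\<close>) and
  \<open>(-1/x)\<^sup>n \<pi>(n)\<close> (\<open>c = -x\<close>).

  For the two alternating chains (\<open>p = x\<^sup>2\<close>, \<open>y = x\<close> or \<open>y = 1/x\<close>) the equation is
  \<open>(1 - cz) F(z) - (1 + y) (1 - z) F(pz) + y (1 - z) (1 - pz) F(p\<^sup>2z) = 0\<close>. Dividing \<open>F\<close> by the entire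
  solution of \<open>N(z) = (1 - z) N(pz)\<close>, \<open>N(0) = 1\<close>, leaves a series with coefficients \<open>F(0) \<gamma>\<^sub>n c\<^sup>n\<close>,
  \<open>\<gamma>\<^sub>n \<ge> 1\<close>. Its divergence at \<open>1/c\<close> forces \<open>N(1/c) = 0\<close>, i.e. \<open>c = p\<^sup>k\<close>. The raising operator is
  \<open>F(z) \<mapsto> (1 - z) F(pz)\<close>.

  For \<open>c = 0\<close> the recurrence can be solved explicitly, and \<open>|\<mu>(n)|\<^sup>2 / \<pi>(n)\<close> does not tend to \<open>0\<close>.
\<close>

subsection \<open>Compactness of tridiagonal operators\<close>

text \<open>\<open>u\<close>, \<open>d\<close> and \<open>l\<close> are the birth, holding and death
  rates, each indexed by the state that is left.\<close>

definition tridiag :: "(nat \<Rightarrow> real) \<Rightarrow> (nat \<Rightarrow> real) \<Rightarrow> (nat \<Rightarrow> real) \<Rightarrow> nat \<Rightarrow> nat \<Rightarrow> real" where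
  "tridiag u d l i j = (if j = i + 1 then u i else if j = i then d i else if i = j + 1 then l i else 0)"

lemma right_mult_tridiag:
  "right_mult (tridiag u d l) \<mu> j =
     (if j = 0 then 0 else \<mu> (j - 1) * u (j - 1)) + \<mu> j * d j + \<mu> (j + 1) * l (j + 1)"
proof -
  have "right_mult (tridiag u d l) \<mu> j = infsum (\<lambda>i. \<mu> i * complex_of_real (tridiag u d l i j)) {j - 1..j + 1}"
    unfolding right_mult_def by (rule infsum_cong_neutral) (auto simp: tridiag_def)
  also have "\<dots> = (\<Sum>i\<in>{j - 1..j + 1}. \<mu> i * complex_of_real (tridiag u d l i j))"
    by simp
  \<comment> \<open>Truncated subtraction gives \<open>0 - 1 = 0\<close>, so for
    \<open>j = 0\<close> the range has two elements and there is no birth term.\<close>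
  also have "{j - 1..j + 1} = (if j = 0 then {0, 1} else {j - 1, j, j + 1})"
    by (auto simp: set_eq_iff)
  also have "(\<Sum>i\<in>\<dots>. \<mu> i * complex_of_real (tridiag u d l i j)) =
      (if j = 0 then 0 else \<mu> (j - 1) * u (j - 1)) + \<mu> j * d j + \<mu> (j + 1) * l (j + 1)"
    by (cases j) (simp_all add: tridiag_def ac_simps)
  finally show ?thesis .
qed

lemma power2_norm_add3_le: "(cmod (a + b + c))\<^sup>2 \<le> 3 * ((cmod a)\<^sup>2 + (cmod b)\<^sup>2 + (cmod c)\<^sup>2)"
proof -
  have "cmod (a + b + c) \<le> cmod a + cmod b + cmod c"
    using norm_triangle_ineq[of "a + b" c] norm_triangle_ineq[of a b] by linarith
  then have "(cmod (a + b + c))\<^sup>2 \<le> (cmod a + cmod b + cmod c)\<^sup>2"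
    by (intro power_mono) auto
  \<comment> \<open>Expanded, this is three times the sum of the squared moduli minus the square of
    their sum.\<close>
  moreover have "0 \<le> (cmod a - cmod b)\<^sup>2 + (cmod b - cmod c)\<^sup>2 + (cmod a - cmod c)\<^sup>2"
    by simp
  ultimately show ?thesis
    by (simp add: power2_eq_square algebra_simps)
qed

section \<open>Weighted l2 spaces and a compactness criterion\<close>

locale l2_weight =
  fixes \<pi> :: "nat \<Rightarrow> real"
  assumes pos: "\<pi> i > 0"
begin

lemma l2_iff_summable:
  shows "\<mu> \<in> l2 \<pi> \<longleftrightarrow> summable (\<lambda>i. (cmod (\<mu> i))\<^sup>2 / \<pi> i)"
  unfolding l2_def using pos by (simp add: summable_on_UNIV_nonneg_real_iff less_imp_le)

lemma l2_norm_eq_suminf: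
  assumes "\<mu> \<in> l2 \<pi>"
  shows "(l2_norm \<pi> \<mu>)\<^sup>2 = (\<Sum>i. (cmod (\<mu> i))\<^sup>2 / \<pi> i)"
proof -
  have s: "summable (\<lambda>i. (cmod (\<mu> i))\<^sup>2 / \<pi> i)"
    using assms by (simp add: l2_iff_summable)
  then have "(\<Sum>\<^sub>\<infinity>i. (cmod (\<mu> i))\<^sup>2 / \<pi> i) = (\<Sum>i. (cmod (\<mu> i))\<^sup>2 / \<pi> i)"
    using pos by (intro infsumI sums_nonneg_imp_has_sum summable_sums) (simp_all add: less_imp_le)
  moreover have "0 \<le> (\<Sum>i. (cmod (\<mu> i))\<^sup>2 / \<pi> i)"
    using s pos by (intro suminf_nonneg) (simp_all add: less_imp_le)
  ultimately show ?thesis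
    by (simp add: l2_norm_altdef)
qed

lemma l2_norm_nonneg:
  shows "0 \<le> l2_norm \<pi> \<mu>"
  using pos by (auto simp: l2_norm_altdef less_imp_le intro!: infsum_nonneg)

lemma l2_coordinate_bound:
  assumes "\<mu> \<in> l2 \<pi>"
  shows "(cmod (\<mu> i))\<^sup>2 / \<pi> i \<le> (l2_norm \<pi> \<mu>)\<^sup>2"
proof -
  have "(\<Sum>j\<in>{i}. (cmod (\<mu> j))\<^sup>2 / \<pi> j) \<le> (\<Sum>j. (cmod (\<mu> j))\<^sup>2 / \<pi> j)"
    using assms by (intro sum_le_suminf) (simp_all add: l2_iff_summable less_imp_le pos)
  with assms show ?thesis
    by (simp add: l2_norm_eq_suminf)
qed

text \<open>A form of dominated convergence: pointwise convergence handles the finitely many indices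
  below \<open>N\<close>, and beyond them small weights multiply a total mass of at most
  \<open>M\<close>.\<close>

lemma suminf_null_weights:
  fixes \<kappa> :: "nat \<Rightarrow> real" and h :: "nat \<Rightarrow> nat \<Rightarrow> real"
  assumes \<kappa>: "\<And>i. 0 \<le> \<kappa> i" "\<kappa> \<longlonglongrightarrow> 0"
    and h: "\<And>n i. 0 \<le> h n i" "\<And>n. summable (h n)" "\<And>n. suminf (h n) \<le> M"
    and lim: "\<And>i. (\<lambda>n. h n i) \<longlonglongrightarrow> 0"
  shows "(\<lambda>n. \<Sum>i. \<kappa> i * h n i) \<longlonglongrightarrow> 0"
proof (rule LIMSEQ_I)
  fix e :: real assume "e > 0"
  \<comment> \<open>\<open>M + 1\<close> keeps the denominator positive even for
    \<open>M = 0\<close>; the tail then costs at most \<open>e / 2\<close>.\<close>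
  define d where "d = e / (2 * (M + 1))"
  have "0 \<le> M"
    using h(3)[of 0] suminf_nonneg[OF h(2)[of 0]] h(1) by (meson order_trans)
  then have "d > 0" using \<open>e > 0\<close> by (simp add: d_def)
  then obtain N where N: "\<And>i. i \<ge> N \<Longrightarrow> \<kappa> i < d"
    using \<kappa>(2) \<kappa>(1) by (fastforce simp: lim_sequentially dist_real_def)
  have "(\<lambda>n. \<Sum>i<N. \<kappa> i * h n i) \<longlonglongrightarrow> (\<Sum>i<N. \<kappa> i * 0)"
    by (intro tendsto_intros lim)
  then obtain n0 where n0: "\<And>n. n \<ge> n0 \<Longrightarrow> (\<Sum>i<N. \<kappa> i * h n i) < e / 2"
    using LIMSEQ_D[of _ 0 "e/2"] \<open>e > 0\<close> by fastforce
  have "norm ((\<Sum>i. \<kappa> i * h n i) - 0) < e" if "n \<ge> n0" for n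
  proof -
    define f where "f = (\<lambda>i. (if i < N then \<kappa> i * h n i else 0))"
    have le: "\<kappa> i * h n i \<le> f i + d * h n i" for i
      using N[of i] h(1)[of n i] \<open>d > 0\<close> by (auto simp: f_def not_less intro: mult_right_mono)
    have f: "f sums (\<Sum>i<N. \<kappa> i * h n i)"
      using sums_If_finite_set[of "{..<N}" "\<lambda>i. \<kappa> i * h n i"] by (simp add: f_def)
    have dh: "(\<lambda>i. d * h n i) sums (d * suminf (h n))"
      by (intro sums_mult summable_sums h)
    note fdh = sums_add[OF f dh]
    have s: "summable (\<lambda>i. \<kappa> i * h n i)"
      by (rule summable_comparison_test'[OF sums_summable[OF fdh], of 0])
         (use le \<kappa> h in \<open>simp add: abs_mult\<close>)
    have "(\<Sum>i. \<kappa> i * h n i) \<le> (\<Sum>i<N. \<kappa> i * h n i) + d * suminf (h n)"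
      using sums_le[OF _ summable_sums[OF s] fdh] le by blast
    also have "d * suminf (h n) \<le> d * (M + 1)"
      using h(3)[of n] \<open>d > 0\<close> by (intro mult_left_mono) auto
    also have "d * (M + 1) = e / 2"
      using \<open>0 \<le> M\<close> by (simp add: d_def field_simps)
    finally have "(\<Sum>i. \<kappa> i * h n i) < e"
      using n0[OF that] by linarith
    moreover have "0 \<le> (\<Sum>i. \<kappa> i * h n i)"
      using s \<kappa> h by (intro suminf_nonneg) auto
    ultimately show ?thesis by simp
  qed
  then show "\<exists>no. \<forall>n\<ge>no. norm ((\<Sum>i. \<kappa> i * h n i) - 0) < e"
    by blast
qed

text \<open>Weak sequential compactness of balls, in coordinates. The coordinate bound puts every
  \<open>\<sigma> n\<close> into a product of closed discs, which is compact by Tychonoff and, as a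
  countable product of metric spaces, sequentially compact.\<close>

lemma l2_bounded_pointwise_subsequence:
  fixes \<sigma> :: "nat \<Rightarrow> nat \<Rightarrow> complex"
  assumes mem: "\<And>n. \<sigma> n \<in> l2 \<pi>" and bd: "\<And>n. l2_norm \<pi> (\<sigma> n) \<le> M"
  obtains \<mu> r where "\<mu> \<in> l2 \<pi>" "l2_norm \<pi> \<mu> \<le> M" "strict_mono r"
    "\<And>i. (\<lambda>n. \<sigma> (r n) i) \<longlonglongrightarrow> \<mu> i"
proof -
  have "0 \<le> M"
    using bd[of 0] l2_norm_nonneg[of "\<sigma> 0"] by linarith
  have M2: "(l2_norm \<pi> (\<sigma> n))\<^sup>2 \<le> M\<^sup>2" for n
    using bd l2_norm_nonneg by (intro power_mono) auto
  define K where "K = (\<Pi>\<^sub>E i\<in>(UNIV::nat set). cball (0::complex) (M * sqrt (\<pi> i)))"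
  have "compactin (product_topology (\<lambda>i. euclidean) UNIV) K"
    unfolding K_def compactin_PiE by simp
  then have K: "seq_compact K"
    by (simp add: compact_eq_seq_compact_metric euclidean_product_topology)
  have \<sigma>K: "\<sigma> n \<in> K" for n
  proof -
    have "cmod (\<sigma> n i) \<le> M * sqrt (\<pi> i)" for i
    proof -
      have "(cmod (\<sigma> n i))\<^sup>2 / \<pi> i \<le> M\<^sup>2"
        using l2_coordinate_bound[OF mem[of n], of i] M2[of n] by linarith
      then have "(cmod (\<sigma> n i))\<^sup>2 \<le> (M * sqrt (\<pi> i))\<^sup>2"
        using pos[of i] by (simp add: pos_divide_le_eq power_mult_distrib)
      then show ?thesis
        by (rule power2_le_imp_le) (use \<open>0 \<le> M\<close> pos[of i] in simp)
    qed
    then show ?thesis by (simp add: K_def PiE_iff)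
  qed
  obtain \<mu> r where r: "strict_mono r" and lim: "(\<sigma> \<circ> r) \<longlonglongrightarrow> \<mu>"
    by (rule seq_compactE[OF K, of \<sigma>]) (use \<sigma>K in simp_all)
  have coord: "(\<lambda>n. \<sigma> (r n) i) \<longlonglongrightarrow> \<mu> i" for i
    using continuous_on_tendsto_compose[OF continuous_on_product_coordinates[of i] lim] by (simp add: o_def)
  \<comment> \<open>Fatou in finite form: the bound on partial sums survives the pointwise limit, so
    \<open>\<mu>\<close> stays in the same ball.\<close>
  have part: "(\<Sum>i<N. (cmod (\<mu> i))\<^sup>2 / \<pi> i) \<le> M\<^sup>2" for N
  proof (rule LIMSEQ_le_const2)
    show "(\<lambda>n. \<Sum>i<N. (cmod (\<sigma> (r n) i))\<^sup>2 / \<pi> i) \<longlonglongrightarrow> (\<Sum>i<N. (cmod (\<mu> i))\<^sup>2 / \<pi> i)"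
      by (intro tendsto_intros coord) (simp add: less_imp_neq[OF pos, symmetric])
    have "(\<Sum>i<N. (cmod (\<sigma> (r n) i))\<^sup>2 / \<pi> i) \<le> M\<^sup>2" for n
    proof -
      have "(\<Sum>i<N. (cmod (\<sigma> (r n) i))\<^sup>2 / \<pi> i) \<le> (\<Sum>i. (cmod (\<sigma> (r n) i))\<^sup>2 / \<pi> i)"
        using mem[of "r n"]
        by (intro sum_le_suminf) (simp_all add: l2_iff_summable less_imp_le pos)
      with M2[of "r n"] show ?thesis
        using l2_norm_eq_suminf[OF mem] by simp
    qed
    then show "\<exists>N'. \<forall>n\<ge>N'. (\<Sum>i<N. (cmod (\<sigma> (r n) i))\<^sup>2 / \<pi> i) \<le> M\<^sup>2"
      by blast
  qed
  have summ: "summable (\<lambda>i. (cmod (\<mu> i))\<^sup>2 / \<pi> i)"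
    using pos part by (intro summableI_nonneg_bounded[where x = "M\<^sup>2"]) (simp_all add: less_imp_le)
  then have \<mu>: "\<mu> \<in> l2 \<pi>"
    by (simp add: l2_iff_summable)
  have "(l2_norm \<pi> \<mu>)\<^sup>2 \<le> M\<^sup>2"
    unfolding l2_norm_eq_suminf[OF \<mu>] using summ part by (rule suminf_le_const)
  then have "l2_norm \<pi> \<mu> \<le> M"
    using \<open>0 \<le> M\<close> by (rule power2_le_imp_le)
  from that[OF \<mu> this r coord] show ?thesis .
qed

text \<open>The null weights \<open>\<kappa>\<close> turn pointwise convergence of a bounded
  sequence into norm convergence of its image. Hence images of closed balls about 0 are compact, and
  the closure of the image of a bounded set is a closed subset of such an image.\<close>

lemma compact_operator_on_l2I:
  assumes add: "\<And>\<mu> \<nu>. T (\<lambda>i. \<mu> i + \<nu> i) = (\<lambda>i. T \<mu> i + T \<nu> i)"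
    and scale: "\<And>c \<mu>. T (\<lambda>i. c * \<mu> i) = (\<lambda>i. c * T \<mu> i)"
    and \<kappa>: "\<And>i. 0 \<le> \<kappa> i" "\<kappa> \<longlonglongrightarrow> 0"
    and mem: "\<And>\<mu>. \<mu> \<in> l2 \<pi> \<Longrightarrow> T \<mu> \<in> l2 \<pi>"
    and bound: "\<And>\<mu>. \<mu> \<in> l2 \<pi> \<Longrightarrow> (l2_norm \<pi> (T \<mu>))\<^sup>2 \<le> (\<Sum>i. \<kappa> i * ((cmod (\<mu> i))\<^sup>2 / \<pi> i))"
  shows "compact_operator_on_l2 \<pi> T"
proof -
  interpret Metric_space "l2 \<pi>" "l2_dist \<pi>"
    by (rule Metric_space_l2) (rule pos)
  have Tdiff: "T (\<lambda>i. \<mu> i - \<nu> i) = (\<lambda>i. T \<mu> i - T \<nu> i)" for \<mu> \<nu>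
    using add[of \<mu> "\<lambda>i. - 1 * \<nu> i"] scale[of "-1" \<nu>] by simp
  have ball: "compactin mtopology (T ` {\<mu> \<in> l2 \<pi>. l2_norm \<pi> \<mu> \<le> M})" (is "compactin _ (T ` ?B)") for M
    unfolding compactin_sequentially
  proof (intro conjI allI impI)
    show "T ` ?B \<subseteq> l2 \<pi>"
      by (rule image_subsetI) (simp add: mem)
    fix \<tau> :: "nat \<Rightarrow> nat \<Rightarrow> complex" assume \<tau>: "range \<tau> \<subseteq> T ` ?B"
    have "\<forall>n. \<exists>\<mu>. \<mu> \<in> ?B \<and> T \<mu> = \<tau> n"
    proof
      fix n
      have "\<tau> n \<in> T ` ?B" using \<tau> by (rule subsetD) simp
      then obtain \<mu> where "\<tau> n = T \<mu>" "\<mu> \<in> ?B" by (rule imageE)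
      then show "\<exists>\<mu>. \<mu> \<in> ?B \<and> T \<mu> = \<tau> n" by (intro exI[of _ \<mu>]) simp
    qed
    from choice[OF this] obtain \<sigma> where "\<forall>n. \<sigma> n \<in> ?B \<and> T (\<sigma> n) = \<tau> n"
      by (elim exE)
    then have \<sigma>: "\<sigma> n \<in> l2 \<pi>" "l2_norm \<pi> (\<sigma> n) \<le> M" "T (\<sigma> n) = \<tau> n" for n
      by simp_all
    obtain \<mu> r where \<mu>: "\<mu> \<in> l2 \<pi>" "l2_norm \<pi> \<mu> \<le> M" and r: "strict_mono r"
      and lim: "\<And>i. (\<lambda>n. \<sigma> (r n) i) \<longlonglongrightarrow> \<mu> i"
      by (rule l2_bounded_pointwise_subsequence[where \<sigma> = \<sigma>, OF \<sigma>(1,2)]) (rule that)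
    \<comment> \<open>These differences have norm at most \<open>2 * M\<close> and tend to 0 in
      every coordinate, as \<open>suminf_null_weights\<close> requires.\<close>
    define w where "w = (\<lambda>n i. \<sigma> (r n) i - \<mu> i)"
    have w: "w n \<in> l2 \<pi>" for n
      unfolding w_def using l2_diff[OF pos \<sigma>(1) \<mu>(1)] .
    have "l2_norm \<pi> (w n) \<le> 2 * M" for n
      using l2_norm_triangle[OF pos \<sigma>(1)[of "r n"] l2_minus[OF \<mu>(1)]] \<sigma>(2)[of "r n"] \<mu>(2)
      by (simp add: w_def l2_norm_altdef)
    then have wM: "(l2_norm \<pi> (w n))\<^sup>2 \<le> (2 * M)\<^sup>2" for n
      using l2_norm_nonneg by (intro power_mono) auto
    have L: "(\<lambda>n. \<Sum>i. \<kappa> i * ((cmod (w n i))\<^sup>2 / \<pi> i)) \<longlonglongrightarrow> 0"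
    proof (rule suminf_null_weights[where \<kappa> = \<kappa>, OF \<kappa>])
      show "0 \<le> (cmod (w n i))\<^sup>2 / \<pi> i" for n i using pos[of i] by simp
      show "summable (\<lambda>i. (cmod (w n i))\<^sup>2 / \<pi> i)" for n
        using w by (simp add: l2_iff_summable)
      show "(\<Sum>i. (cmod (w n i))\<^sup>2 / \<pi> i) \<le> (2 * M)\<^sup>2" for n
        using wM[of n] l2_norm_eq_suminf[OF w, of n] by simp
      fix i
      have "(\<lambda>n. (cmod (w n i))\<^sup>2 / \<pi> i) \<longlonglongrightarrow> (cmod (\<mu> i - \<mu> i))\<^sup>2 / \<pi> i"
        unfolding w_def using pos[of i] by (intro tendsto_intros lim) auto
      then show "(\<lambda>n. (cmod (w n i))\<^sup>2 / \<pi> i) \<longlonglongrightarrow> 0" by simp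
    qed
    have Tw: "(l2_norm \<pi> (T (w n)))\<^sup>2 \<le> (\<Sum>i. \<kappa> i * ((cmod (w n i))\<^sup>2 / \<pi> i))" for n
      by (rule bound[OF w])
    have "(\<lambda>n. (l2_norm \<pi> (T (w n)))\<^sup>2) \<longlonglongrightarrow> 0"
      by (rule tendsto_sandwich[OF _ _ tendsto_const L]; intro always_eventually allI; (rule Tw | simp))
    then have "(\<lambda>n. sqrt ((l2_norm \<pi> (T (w n)))\<^sup>2)) \<longlonglongrightarrow> sqrt 0"
      by (rule tendsto_real_sqrt)
    then have "(\<lambda>n. l2_dist \<pi> (\<tau> (r n)) (T \<mu>)) \<longlonglongrightarrow> 0"
      by (simp add: w_def Tdiff l2_dist_def \<sigma>(3) l2_norm_nonneg)
    moreover have "\<tau> n \<in> l2 \<pi>" for n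
      using mem[OF \<sigma>(1)[of n]] by (simp add: \<sigma>(3))
    ultimately have lim_T: "limitin mtopology (\<tau> \<circ> r) (T \<mu>) sequentially"
      using mem[OF \<mu>(1)] by (simp add: limitin_metric_dist_null o_def)
    have "T \<mu> \<in> T ` ?B"
      by (rule imageI) (simp add: \<mu>)
    with lim_T r show "\<exists>l r. l \<in> T ` ?B \<and> strict_mono r \<and> limitin mtopology (\<tau> \<circ> r) l sequentially"
      by (intro exI[of _ "T \<mu>"] exI[of _ r]) simp
  qed
  have closure: "compactin mtopology (mtopology closure_of (T ` B))" if B: "mbounded B" for B
  proof -
    obtain \<nu> C where C: "B \<subseteq> mcball \<nu> C" using B by (auto simp: mbounded_def)
    \<comment> \<open>Recentring the ball from \<open>\<nu>\<close> to 0 enlarges its radius by the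
      norm of \<open>\<nu>\<close>.\<close>
    have "B \<subseteq> {\<mu> \<in> l2 \<pi>. l2_norm \<pi> \<mu> \<le> l2_norm \<pi> \<nu> + C}"
    proof
      fix \<mu> assume "\<mu> \<in> B"
      with C have "\<mu> \<in> mcball \<nu> C" by (rule subsetD)
      then have *: "\<mu> \<in> l2 \<pi>" "\<nu> \<in> l2 \<pi>" "l2_dist \<pi> \<mu> \<nu> \<le> C"
        by (simp_all add: commute)
      have "l2_norm \<pi> \<mu> \<le> l2_norm \<pi> \<nu> + l2_dist \<pi> \<mu> \<nu>"
        using l2_norm_triangle[OF pos *(2) l2_diff[OF pos *(1,2)]] by (simp add: l2_dist_def)
      with * show "\<mu> \<in> {\<mu> \<in> l2 \<pi>. l2_norm \<pi> \<mu> \<le> l2_norm \<pi> \<nu> + C}"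
        by simp
    qed
    then have sub: "T ` B \<subseteq> T ` {\<mu> \<in> l2 \<pi>. l2_norm \<pi> \<mu> \<le> l2_norm \<pi> \<nu> + C}"
      by (rule image_mono)
    show ?thesis
      by (rule closed_compactin[OF ball closure_of_minimal[OF sub] closedin_closure_of])
         (rule compactin_imp_closedin[OF Hausdorff_space_mtopology ball])
  qed
  show ?thesis
    unfolding compact_operator_on_l2_def
    by (intro conjI ballI allI impI image_subsetI; (rule mem add scale closure)?)
qed

text \<open>Detailed balance turns \<open>(u i)\<^sup>2 / \<pi> (Suc i)\<close> into
  \<open>u i * l (Suc i) / \<pi> i\<close>, and similarly for the death rates. So the off-diagonal
  part is controlled by the products \<open>u i * l (Suc i)\<close>, which can tend to 0 while
  \<open>l\<close> tends to 1.\<close>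

lemma compact_operator_tridiag:
  assumes rev: "\<And>i. \<pi> i * u i = \<pi> (Suc i) * l (Suc i)"
    and ul: "(\<lambda>i. u i * l (Suc i)) \<longlonglongrightarrow> 0" and d: "d \<longlonglongrightarrow> 0"
  shows "compact_operator_on_l2 \<pi> (right_mult (tridiag u d l))"
proof (rule compact_operator_on_l2I)
  define T where "T = right_mult (tridiag u d l)"
  define s where "s = (\<lambda>i. u i * l (Suc i))"
  \<comment> \<open>The 3 comes from \<open>power2_norm_add3_le\<close>. The three summands are the
    contributions of \<open>\<mu> i\<close> to the coordinates \<open>i + 1\<close>,
    \<open>i\<close> and \<open>i - 1\<close> of the image.\<close>
  define \<kappa> where "\<kappa> = (\<lambda>i. 3 * (s i + (d i)\<^sup>2 + (if i = 0 then 0 else s (i - 1))))"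
  have s0: "0 \<le> s i" for i
  proof -
    have "u i = \<pi> (Suc i) * l (Suc i) / \<pi> i" using rev[of i] pos[of i] by (simp add: field_simps)
    then have "s i = \<pi> (Suc i) * (l (Suc i))\<^sup>2 / \<pi> i"
      by (simp add: s_def power2_eq_square)
    then show ?thesis using pos[of i] pos[of "Suc i"] by (simp add: less_imp_le)
  qed
  show \<kappa>0: "0 \<le> \<kappa> i" for i using s0 by (simp add: \<kappa>_def)
  have "(\<lambda>i. \<kappa> (Suc i)) \<longlonglongrightarrow> 3 * (0 + 0\<^sup>2 + 0)"
    unfolding \<kappa>_def using LIMSEQ_Suc[OF ul] LIMSEQ_Suc[OF d] ul
    by (intro tendsto_intros) (simp_all add: s_def)
  then show \<kappa>lim: "\<kappa> \<longlonglongrightarrow> 0" by (simp add: filterlim_sequentially_Suc)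
  have main: "summable (\<lambda>j. (cmod (T \<mu> j))\<^sup>2 / \<pi> j) \<and>
      (\<Sum>j. (cmod (T \<mu> j))\<^sup>2 / \<pi> j) \<le> (\<Sum>i. \<kappa> i * ((cmod (\<mu> i))\<^sup>2 / \<pi> i))" if "\<mu> \<in> l2 \<pi>" for \<mu>
  proof -
    define h where "h = (\<lambda>i. (cmod (\<mu> i))\<^sup>2 / \<pi> i)"
    have h0: "0 \<le> h i" for i using pos[of i] by (simp add: h_def)
    have hs: "summable h" using that by (simp add: l2_iff_summable h_def)
    have "Bseq \<kappa>" using \<kappa>lim by (intro convergent_imp_Bseq) (auto simp: convergent_def)
    then obtain K where K: "\<And>i. norm (\<kappa> i) \<le> K" by (auto simp: Bseq_def)
    have \<kappa>h: "summable (\<lambda>i. \<kappa> i * h i)"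
    proof (rule summable_comparison_test'[OF summable_mult[OF hs, of K], of 0])
      show "norm (\<kappa> i * h i) \<le> K * h i" for i
        using K[of i] h0[of i] by (simp add: abs_mult mult_right_mono)
    qed
    have T: "(cmod (T \<mu> j))\<^sup>2 / \<pi> j \<le>
        3 * ((if j = 0 then 0 else s (j - 1) * h (j - 1)) + (d j)\<^sup>2 * h j + s j * h (Suc j))" for j
    proof -
      have e1: "(cmod (if j = 0 then 0 else \<mu> (j - 1) * u (j - 1)))\<^sup>2 / \<pi> j =
          (if j = 0 then 0 else s (j - 1) * h (j - 1))"
      proof (cases j)
        case (Suc k)
        have "u k / \<pi> j = l (Suc k) / \<pi> k"
          using rev[of k] pos[of k] pos[of j] by (simp add: Suc field_simps)
        moreover have "(cmod (\<mu> k * u k))\<^sup>2 / \<pi> j = (cmod (\<mu> k))\<^sup>2 * u k * (u k / \<pi> j)"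
          by (simp add: norm_mult power_mult_distrib power2_eq_square)
        ultimately show ?thesis
          by (simp add: Suc s_def h_def)
      qed simp
      have e2: "(cmod (\<mu> j * d j))\<^sup>2 / \<pi> j = (d j)\<^sup>2 * h j"
        by (simp add: h_def norm_mult power_mult_distrib)
      have "l (Suc j) / \<pi> j = u j / \<pi> (Suc j)"
        using rev[of j] pos[of j] pos[of "Suc j"] by (simp add: field_simps)
      moreover have "(cmod (\<mu> (j + 1) * l (j + 1)))\<^sup>2 / \<pi> j = (cmod (\<mu> (Suc j)))\<^sup>2 * l (Suc j) * (l (Suc j) / \<pi> j)"
        by (simp add: norm_mult power_mult_distrib power2_eq_square)
      ultimately have e3: "(cmod (\<mu> (j + 1) * l (j + 1)))\<^sup>2 / \<pi> j = s j * h (Suc j)"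
        by (simp add: s_def h_def)
      have "(cmod (T \<mu> j))\<^sup>2 / \<pi> j \<le> 3 * ((cmod (if j = 0 then 0 else \<mu> (j - 1) * u (j - 1)))\<^sup>2
          + (cmod (\<mu> j * d j))\<^sup>2 + (cmod (\<mu> (j + 1) * l (j + 1)))\<^sup>2) / \<pi> j"
        unfolding T_def right_mult_tridiag
        using pos[of j] by (intro divide_right_mono power2_norm_add3_le) simp
      also have "\<dots> = 3 * ((cmod (if j = 0 then 0 else \<mu> (j - 1) * u (j - 1)))\<^sup>2 / \<pi> j
          + (cmod (\<mu> j * d j))\<^sup>2 / \<pi> j + (cmod (\<mu> (j + 1) * l (j + 1)))\<^sup>2 / \<pi> j)"
        by (simp add: add_divide_distrib)
      finally show ?thesis
        by (simp only: e1 e2 e3)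
    qed
    have part: "(\<Sum>j<N. (cmod (T \<mu> j))\<^sup>2 / \<pi> j) \<le> (\<Sum>i. \<kappa> i * h i)" for N
    proof -
      have "(\<Sum>j<N. (cmod (T \<mu> j))\<^sup>2 / \<pi> j) \<le>
          3 * ((\<Sum>j<N. (if j = 0 then 0 else s (j - 1) * h (j - 1))) + (\<Sum>j<N. (d j)\<^sup>2 * h j) + (\<Sum>j<N. s j * h (Suc j)))"
        using sum_mono[of "{..<N}", OF T] by (simp add: sum.distrib sum_distrib_left)
      \<comment> \<open>One more index than on the left: the image coordinate \<open>N - 1\<close>
        already involves \<open>h N\<close>.\<close>
      also have "\<dots> \<le> (\<Sum>i<Suc N. \<kappa> i * h i)"
      proof -
        have a: "(\<Sum>j<N. (if j = 0 then 0 else s (j - 1) * h (j - 1))) \<le> (\<Sum>j<Suc N. s j * h j)"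
        proof (cases N)
          case (Suc n)
          show ?thesis unfolding Suc
            by (subst sum.lessThan_Suc_shift) (simp add: s0 h0)
        qed (simp add: s0 h0)
        have b: "(\<Sum>j<N. s j * h (Suc j)) = (\<Sum>j<Suc N. (if j = 0 then 0 else s (j - 1) * h j))"
          by (subst sum.lessThan_Suc_shift) simp
        have c: "(\<Sum>j<N. (d j)\<^sup>2 * h j) \<le> (\<Sum>j<Suc N. (d j)\<^sup>2 * h j)"
          by (simp add: h0)
        have "(\<Sum>i<Suc N. \<kappa> i * h i) = 3 * ((\<Sum>j<Suc N. s j * h j) + (\<Sum>j<Suc N. (d j)\<^sup>2 * h j)
            + (\<Sum>j<Suc N. (if j = 0 then 0 else s (j - 1) * h j)))"
          unfolding sum.distrib[symmetric] sum_distrib_left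
          by (intro sum.cong refl) (simp add: \<kappa>_def algebra_simps)
        then show ?thesis
          unfolding b by (simp only:) (intro mult_left_mono add_mono a c order_refl, simp)
      qed
      also have "\<dots> \<le> (\<Sum>i. \<kappa> i * h i)"
        using \<kappa>h \<kappa>0 h0 by (intro sum_le_suminf) auto
      finally show ?thesis .
    qed
    have "summable (\<lambda>j. (cmod (T \<mu> j))\<^sup>2 / \<pi> j)"
      using pos part by (intro summableI_nonneg_bounded) (auto simp: less_imp_le)
    with suminf_le_const[OF this part] show ?thesis by (simp add: h_def)
  qed
  show mem: "right_mult (tridiag u d l) \<mu> \<in> l2 \<pi>" if "\<mu> \<in> l2 \<pi>" for \<mu>
    using main[OF that] by (simp add: l2_iff_summable T_def)
  show "(l2_norm \<pi> (right_mult (tridiag u d l) \<mu>))\<^sup>2 \<le> (\<Sum>i. \<kappa> i * ((cmod (\<mu> i))\<^sup>2 / \<pi> i))"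
    if "\<mu> \<in> l2 \<pi>" for \<mu>
    using main[OF that] l2_norm_eq_suminf[OF mem[OF that]] by (simp add: T_def)
qed (auto simp: right_mult_tridiag fun_eq_iff algebra_simps)

end

subsection \<open>Generating functions\<close>

text \<open>The dilation F(z) -> F(pz). It expresses the factors \<open>p ^ n\<close> of the
  transition rates on generating functions.\<close>

definition fps_scale :: "'a::comm_ring_1 \<Rightarrow> 'a fps \<Rightarrow> 'a fps" where
  "fps_scale p F = Abs_fps (\<lambda>n. p ^ n * fps_nth F n)"

lemma fps_nth_scale [simp]: "fps_nth (fps_scale p F) n = p ^ n * fps_nth F n"
  by (simp add: fps_scale_def)

lemma fps_scale_add: "fps_scale p (F + G) = fps_scale p F + fps_scale p G"
  by (simp add: fps_eq_iff distrib_left)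

lemma fps_scale_diff: "fps_scale p (F - G) = fps_scale p F - fps_scale p G"
  by (simp add: fps_eq_iff right_diff_distrib)

text \<open>Dilation is composition with \<open>p * X\<close>, hence multiplicative.\<close>

lemma fps_scale_mult: "fps_scale p (F * G) = fps_scale p F * fps_scale p (G :: 'a::idom fps)"
proof -
  have "fps_scale p H = fps_compose H (fps_const p * fps_X)" for H :: "'a fps"
    by (simp add: fps_scale_def fps_compose_linear)
  then show ?thesis
    by (simp add: fps_compose_mult_distrib)
qed

lemma fps_scale_1 [simp]: "fps_scale p 1 = 1"
  by (simp add: fps_eq_iff)

lemma fps_scale_const [simp]: "fps_scale p (fps_const c) = fps_const c"
  by (simp add: fps_eq_iff)

lemma fps_scale_X [simp]: "fps_scale p fps_X = fps_const p * fps_X"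
  by (simp add: fps_eq_iff fps_X_def)

lemma fps_scale_scale [simp]: "fps_scale p (fps_scale r F) = fps_scale (p * r) F"
  by (simp add: fps_eq_iff power_mult_distrib mult.assoc)

lemmas fps_scale_simps = fps_scale_add fps_scale_diff fps_scale_mult

lemma eval_fps_scale: "eval_fps (fps_scale p F) z = eval_fps F (p * z)"
  by (simp add: eval_fps_def power_mult_distrib mult.left_commute mult.commute)

section \<open>Entire power series and their zeros\<close>

lemma fps_conv_radius_mult_infty [simp]:
  "fps_conv_radius f = \<infinity> \<Longrightarrow> fps_conv_radius g = \<infinity> \<Longrightarrow> fps_conv_radius (f * g) = \<infinity>"
  using fps_conv_radius_mult[of f g] by simp

lemma fps_conv_radius_add_infty [simp]:
  "fps_conv_radius f = \<infinity> \<Longrightarrow> fps_conv_radius g = \<infinity> \<Longrightarrow> fps_conv_radius (f + g) = \<infinity>"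
  using fps_conv_radius_add[of f g] by simp

lemma fps_conv_radius_diff_infty [simp]:
  "fps_conv_radius f = \<infinity> \<Longrightarrow> fps_conv_radius g = \<infinity> \<Longrightarrow> fps_conv_radius (f - g) = \<infinity>"
  using fps_conv_radius_diff[of f g] by simp

lemma fps_nth_Abs_fps_eta [simp]: "fps_nth (Abs_fps f) = f"
  by (rule ext) simp

lemma fps_conv_radius_scale_infty:
  assumes "fps_conv_radius F = \<infinity>"
  shows "fps_conv_radius (fps_scale p F) = \<infinity>"
  unfolding fps_conv_radius_def
proof (rule conv_radius_inftyI'')
  fix z
  have "summable (\<lambda>n. fps_nth F n * (p * z) ^ n)"
    by (rule summable_fps) (simp add: assms)
  then show "summable (\<lambda>n. fps_nth (fps_scale p F) n * z ^ n)"
    by (simp add: power_mult_distrib mult_ac)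
qed

lemma summable_mult_power_of_ratio_tendsto_0:
  fixes a :: "nat \<Rightarrow> real"
  assumes pos: "\<And>n. a n > 0" and lim: "(\<lambda>n. a (Suc n) / a n) \<longlonglongrightarrow> 0"
  shows "summable (\<lambda>n. a n * r ^ n)"
proof -
  have "(\<lambda>n. a (Suc n) / a n * \<bar>r\<bar>) \<longlonglongrightarrow> 0 * \<bar>r\<bar>"
    by (intro tendsto_intros lim)
  then have "eventually (\<lambda>n. a (Suc n) / a n * \<bar>r\<bar> < 1 / 2) sequentially"
    by (rule order_tendstoD(2)) simp
  then obtain N where N: "\<And>n. n \<ge> N \<Longrightarrow> a (Suc n) / a n * \<bar>r\<bar> < 1 / 2"
    by (auto simp: eventually_sequentially)
  show ?thesis
  proof (rule summable_ratio_test[of "1 / 2" N])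
    fix n assume "N \<le> n"
    have "norm (a (Suc n) * r ^ Suc n) = (a (Suc n) / a n * \<bar>r\<bar>) * norm (a n * r ^ n)"
      using pos[of n] pos[of "Suc n"] by (simp add: abs_mult power_abs)
    also have "\<dots> \<le> 1 / 2 * norm (a n * r ^ n)"
      using N[OF \<open>N \<le> n\<close>] by (intro mult_right_mono) auto
    finally show "norm (a (Suc n) * r ^ Suc n) \<le> 1 / 2 * norm (a n * r ^ n)" .
  qed simp
qed

lemma fps_conv_radius_infty_of_bound:
  fixes a :: "nat \<Rightarrow> real" and F :: "complex fps"
  assumes pos: "\<And>n. a n > 0" and lim: "(\<lambda>n. a (Suc n) / a n) \<longlonglongrightarrow> 0"
    and le: "\<And>n. cmod (fps_nth F n) \<le> a n"
  shows "fps_conv_radius F = \<infinity>"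
  unfolding fps_conv_radius_def
proof (rule conv_radius_inftyI'')
  fix z :: complex
  have "summable (\<lambda>n. a n * cmod z ^ n)"
    using pos lim by (rule summable_mult_power_of_ratio_tendsto_0)
  then show "summable (\<lambda>n. fps_nth F n * z ^ n)"
    by (rule summable_comparison_test'[where N = 0])
       (simp add: norm_mult norm_power mult_right_mono le)
qed

text \<open>The zeros accumulate at 0, so continuity gives F(0) = 0. They start at
  \<open>p * a\<close> because for the linear kernels the functional equation does not determine F
  at \<open>a = 1 / c\<close>.\<close>

lemma fps_nth_0_eq_0_of_zeros:
  fixes F :: "complex fps"
  assumes F: "fps_conv_radius F = \<infinity>" and p: "cmod p < 1"
    and zeros: "\<And>n. eval_fps F (p ^ Suc n * a) = 0"
  shows "fps_nth F 0 = 0"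
proof -
  have "isCont (eval_fps F) 0"
    using continuous_on_eval_fps[of F] by (simp add: F continuous_on_eq_continuous_at)
  moreover have "(\<lambda>n. p ^ n * a) \<longlonglongrightarrow> 0 * a"
    using p by (intro tendsto_intros LIMSEQ_power_zero)
  then have "(\<lambda>n. p ^ Suc n * a) \<longlonglongrightarrow> 0"
    by (intro LIMSEQ_Suc) simp
  ultimately have "(\<lambda>n. eval_fps F (p ^ Suc n * a)) \<longlonglongrightarrow> eval_fps F 0"
    by (rule isCont_tendsto_compose)
  then have "eval_fps F 0 = 0"
    unfolding zeros by (simp add: LIMSEQ_const_iff)
  then show ?thesis
    by (simp add: eval_fps_at_0)
qed

section \<open>Eigenvectors of tridiagonal matrices\<close>

text \<open>The factor \<open>fps_X\<close> undoes the downward shift in the death term;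
  \<open>l 0 = 0\<close> makes the constant terms agree.\<close>

lemma fps_X_mult_right_mult_tridiag:
  assumes "l 0 = 0"
  shows "fps_X * Abs_fps (right_mult (tridiag u d l) \<mu>) =
    Abs_fps (\<lambda>n. of_real (l n) * \<mu> n) + fps_X * Abs_fps (\<lambda>n. of_real (d n) * \<mu> n)
      + fps_X * (fps_X * Abs_fps (\<lambda>n. of_real (u n) * \<mu> n))"
proof (rule fps_ext)
  fix n
  consider "n = 0" | "n = 1" | m where "n = Suc (Suc m)"
    by (metis One_nat_def old.nat.exhaust)
  then show "fps_nth (fps_X * Abs_fps (right_mult (tridiag u d l) \<mu>)) n =
    fps_nth (Abs_fps (\<lambda>n. of_real (l n) * \<mu> n) + fps_X * Abs_fps (\<lambda>n. of_real (d n) * \<mu> n)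
      + fps_X * (fps_X * Abs_fps (\<lambda>n. of_real (u n) * \<mu> n))) n"
    by cases (simp_all add: right_mult_tridiag assms mult.commute add.commute)
qed

text \<open>Equation \<open>j\<close> can be solved for \<open>\<mu> (Suc j)\<close>, so an
  eigenvector is determined by its first entry.\<close>

lemma eigenvector_tridiag_eq_0:
  assumes l: "\<And>n. l (Suc n) \<noteq> 0" and eig: "right_mult (tridiag u d l) \<mu> = (\<lambda>i. c * \<mu> i)" and "\<mu> 0 = 0"
  shows "\<mu> = (\<lambda>i. 0)"
proof -
  have "\<mu> n = 0" for n
  proof (induction n rule: less_induct)
    case (less n)
    show ?case
    proof (cases n)
      case (Suc j)
      have "\<mu> j = 0" "j \<noteq> 0 \<Longrightarrow> \<mu> (j - 1) = 0"
        using less Suc by simp_all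
      moreover have "right_mult (tridiag u d l) \<mu> j = c * \<mu> j"
        using eig by simp
      ultimately show ?thesis
        using l[of j] unfolding right_mult_tridiag by (cases "j = 0") (simp_all add: Suc)
    qed (simp add: assms)
  qed
  then show ?thesis by blast
qed

text \<open>The hypothesis on \<open>r\<close> says that \<open>r ^ n\<close> is an eigenfunction of
  the matrix acting on columns; by reversibility, multiplication by \<open>\<pi>\<close> makes it a
  row eigenvector.\<close>

lemma eigenvector_tridiag_geometric:
  assumes rev: "\<And>i. \<pi> i * u i = \<pi> (Suc i) * l (Suc i)" and "l 0 = 0"
    and r: "r \<noteq> 0" "\<And>i. l i / r + d i + r * u i = c"
  shows "right_mult (tridiag u d l) (\<lambda>n. of_real (r ^ n * \<pi> n)) = (\<lambda>n. of_real c * of_real (r ^ n * \<pi> n))"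
proof
  fix j
  have e1: "(if j = 0 then 0 else r ^ (j - 1) * \<pi> (j - 1) * u (j - 1)) = r ^ j * \<pi> j * (l j / r)"
  proof (cases j)
    case (Suc k)
    have "r ^ k * \<pi> k * u k = r ^ k * (\<pi> (Suc k) * l (Suc k))"
      using rev[of k] by simp
    then show ?thesis using r(1) by (simp add: Suc)
  qed (simp add: assms)
  have e2: "r ^ (j + 1) * \<pi> (j + 1) * l (j + 1) = r ^ j * \<pi> j * (r * u j)"
    using rev[of j] by simp
  have "(if j = 0 then 0 else r ^ (j - 1) * \<pi> (j - 1) * u (j - 1)) + r ^ j * \<pi> j * d j
      + r ^ (j + 1) * \<pi> (j + 1) * l (j + 1) = r ^ j * \<pi> j * (l j / r + d j + r * u j)"
    unfolding e1 e2 by (simp add: distrib_left)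
  also have "\<dots> = c * (r ^ j * \<pi> j)"
    unfolding r(2) by simp
  finally have "complex_of_real ((if j = 0 then 0 else r ^ (j - 1) * \<pi> (j - 1) * u (j - 1)) + r ^ j * \<pi> j * d j
      + r ^ (j + 1) * \<pi> (j + 1) * l (j + 1)) = of_real (c * (r ^ j * \<pi> j))"
    by (rule arg_cong)
  then show "right_mult (tridiag u d l) (\<lambda>n. of_real (r ^ n * \<pi> n)) j = of_real c * of_real (r ^ j * \<pi> j)"
    by (cases "j = 0") (simp_all add: right_mult_tridiag)
qed

text \<open>The right side is the left side times \<open>e / (x * d)\<close>, which is at least 1.
  This is one step of showing that the squares divided by \<open>\<pi>\<close> do not decrease when
  the entries change by \<open>t / d\<close> and the weight by
  \<open>x * t\<^sup>2 / (d * e)\<close>.\<close>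

lemma weighted_square_step:
  fixes d e t x P M :: real
  assumes "0 < d" "t \<noteq> 0" "0 < x" "0 < P" "x * d \<le> e"
  shows "M\<^sup>2 / P \<le> (t / d * M)\<^sup>2 / (P * (x * t\<^sup>2 / (d * e)))"
proof -
  have xd: "0 < x * d" using assms by simp
  then have "0 < e" using assms by linarith
  have "1 * (M\<^sup>2 / P) \<le> e / (x * d) * (M\<^sup>2 / P)"
    using assms xd by (intro mult_right_mono) simp_all
  also have "\<dots> = (t / d * M)\<^sup>2 / (P * (x * t\<^sup>2 / (d * e)))"
    using assms \<open>0 < e\<close> by (simp add: field_simps power2_eq_square)
  finally show ?thesis by simp
qed

section \<open>Superexponentially decaying weights\<close>

text \<open>\<open>ratio\<close> makes generating functions of \<open>l2\<close> sequences entire.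
  \<open>D\<close> bounds the decay from below, so that a shift by one index costs only a geometric
  factor.\<close>

locale rapid_weight = l2_weight +
  fixes D :: real
  assumes ratio: "(\<lambda>n. \<pi> (Suc n) / \<pi> n) \<longlonglongrightarrow> 0"
    and D: "0 \<le> D" "\<pi> n \<le> D ^ Suc n * \<pi> (Suc n)"
begin

lemma l2_tendsto_0:
  assumes "\<mu> \<in> l2 \<pi>"
  shows "(\<lambda>n. (cmod (\<mu> n))\<^sup>2 / \<pi> n) \<longlonglongrightarrow> 0"
  using assms by (intro summable_LIMSEQ_zero) (simp add: l2_iff_summable)

text \<open>Each entry is at most the norm times \<open>sqrt (\<pi> n)\<close>, whose successive
  ratios tend to 0. The majorant uses \<open>M + 1\<close> to stay positive when the norm is
  0.\<close>

lemma fps_conv_radius_l2: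
  assumes "\<mu> \<in> l2 \<pi>"
  shows "fps_conv_radius (Abs_fps \<mu>) = \<infinity>"
proof (rule fps_conv_radius_infty_of_bound)
  define M where "M = l2_norm \<pi> \<mu>"
  have M: "0 \<le> M" by (simp add: M_def l2_norm_nonneg)
  show "0 < (M + 1) * sqrt (\<pi> n)" for n
    using M pos[of n] by simp
  have "(\<lambda>n. sqrt (\<pi> (Suc n) / \<pi> n)) \<longlonglongrightarrow> sqrt 0"
    by (intro tendsto_real_sqrt ratio)
  then show "(\<lambda>n. (M + 1) * sqrt (\<pi> (Suc n)) / ((M + 1) * sqrt (\<pi> n))) \<longlonglongrightarrow> 0"
    using M by (simp add: real_sqrt_divide)
  fix n
  have "(cmod (\<mu> n))\<^sup>2 \<le> (M * sqrt (\<pi> n))\<^sup>2"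
    using l2_coordinate_bound[OF assms, of n] pos[of n] by (simp add: pos_divide_le_eq power_mult_distrib M_def)
  then have "cmod (\<mu> n) \<le> M * sqrt (\<pi> n)"
    by (rule power2_le_imp_le) (use M pos[of n] in simp)
  also have "\<dots> \<le> (M + 1) * sqrt (\<pi> n)"
    using pos[of n] by (simp add: mult_right_mono)
  finally show "cmod (fps_nth (Abs_fps \<mu>) n) \<le> (M + 1) * sqrt (\<pi> n)" by simp
qed

text \<open>Unlike \<open>l2 \<pi>\<close> itself, this class of sequences is closed under the shift, which is unbounded
  because \<open>\<pi>\<close> decays superexponentially.\<close>

definition tame :: "complex fps \<Rightarrow> bool" where
  "tame F \<longleftrightarrow> (\<exists>C\<ge>0. \<exists>K\<ge>0. \<forall>n. cmod (fps_nth F n) \<le> C * K ^ n * \<pi> n)"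

lemma tameI:
  assumes "\<And>n. cmod (fps_nth F n) \<le> C * K ^ n * \<pi> n" "0 \<le> C" "0 \<le> K"
  shows "tame F"
  using assms unfolding tame_def by blast

text \<open>After squaring and dividing by \<open>\<pi> n\<close>, one factor \<open>\<pi> n\<close>
  is left, and it beats every geometric factor.\<close>

lemma tame_in_l2:
  assumes "tame F"
  shows "fps_nth F \<in> l2 \<pi>"
proof -
  obtain C K where CK: "0 \<le> C" "0 \<le> K" "\<And>n. cmod (fps_nth F n) \<le> C * K ^ n * \<pi> n"
    using assms unfolding tame_def by blast
  have le: "(cmod (fps_nth F n))\<^sup>2 / \<pi> n \<le> C\<^sup>2 * (\<pi> n * (K\<^sup>2) ^ n)" for n
  proof -
    have "(cmod (fps_nth F n))\<^sup>2 \<le> (C * K ^ n * \<pi> n)\<^sup>2"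
      by (rule power_mono[OF CK(3)]) simp
    then show ?thesis
      using pos[of n] by (simp add: pos_divide_le_eq power_mult_distrib power2_eq_square mult_ac)
  qed
  have "summable (\<lambda>n. C\<^sup>2 * (\<pi> n * (K\<^sup>2) ^ n))"
    using summable_mult_power_of_ratio_tendsto_0[where a = \<pi>, OF pos ratio] by (rule summable_mult)
  then have "summable (\<lambda>n. (cmod (fps_nth F n))\<^sup>2 / \<pi> n)"
    by (rule summable_comparison_test'[where N = 0]) (simp add: le pos less_imp_le)
  then show ?thesis by (simp add: l2_iff_summable)
qed

lemma tame_add:
  assumes "tame F" "tame G"
  shows "tame (F + G)"
proof -
  obtain C K where F: "0 \<le> C" "0 \<le> K" "\<And>n. cmod (fps_nth F n) \<le> C * K ^ n * \<pi> n"
    using assms(1) unfolding tame_def by blast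
  obtain C' K' where G: "0 \<le> C'" "0 \<le> K'" "\<And>n. cmod (fps_nth G n) \<le> C' * K' ^ n * \<pi> n"
    using assms(2) unfolding tame_def by blast
  show ?thesis
  proof (rule tameI)
    fix n
    have "cmod (fps_nth (F + G) n) \<le> cmod (fps_nth F n) + cmod (fps_nth G n)"
      by (simp add: norm_triangle_ineq)
    also have "\<dots> \<le> C * K ^ n * \<pi> n + C' * K' ^ n * \<pi> n"
      by (intro add_mono F(3) G(3))
    also have "\<dots> \<le> C * max K K' ^ n * \<pi> n + C' * max K K' ^ n * \<pi> n"
      using F G pos[of n] by (intro add_mono mult_right_mono mult_left_mono power_mono) simp_all
    finally show "cmod (fps_nth (F + G) n) \<le> (C + C') * max K K' ^ n * \<pi> n"
      by (simp add: distrib_right)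
  qed (use F G in simp_all)
qed

lemma tame_const_mult:
  assumes "tame F"
  shows "tame (fps_const c * F)"
proof -
  obtain C K where F: "0 \<le> C" "0 \<le> K" "\<And>n. cmod (fps_nth F n) \<le> C * K ^ n * \<pi> n"
    using assms unfolding tame_def by blast
  show ?thesis
  proof (rule tameI)
    show "cmod (fps_nth (fps_const c * F) n) \<le> (cmod c * C) * K ^ n * \<pi> n" for n
      using mult_left_mono[OF F(3), of "cmod c" n] by (simp add: norm_mult mult.assoc)
  qed (use F in simp_all)
qed

lemma tame_scale:
  assumes "tame F"
  shows "tame (fps_scale c F)"
proof -
  obtain C K where F: "0 \<le> C" "0 \<le> K" "\<And>n. cmod (fps_nth F n) \<le> C * K ^ n * \<pi> n"
    using assms unfolding tame_def by blast
  show ?thesis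
  proof (rule tameI)
    show "cmod (fps_nth (fps_scale c F) n) \<le> C * (cmod c * K) ^ n * \<pi> n" for n
      using mult_left_mono[OF F(3), of "cmod c ^ n" n] by (simp add: norm_mult norm_power power_mult_distrib mult_ac)
  qed (use F in simp_all)
qed

lemma tame_X_mult:
  assumes "tame F"
  shows "tame (fps_X * F)"
proof -
  obtain C K where F: "0 \<le> C" "0 \<le> K" "\<And>n. cmod (fps_nth F n) \<le> C * K ^ n * \<pi> n"
    using assms unfolding tame_def by blast
  show ?thesis
  proof (rule tameI)
    \<comment> \<open>\<open>K + 1\<close> is at least 1, so its exponent may be raised from
      \<open>m\<close> to \<open>Suc m\<close>; the powers of \<open>D\<close> pay for replacing
      \<open>\<pi> m\<close> by \<open>\<pi> (Suc m)\<close>.\<close>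
    fix n show "cmod (fps_nth (fps_X * F) n) \<le> C * ((K + 1) * D) ^ n * \<pi> n"
    proof (cases n)
      case (Suc m)
      have "cmod (fps_nth F m) \<le> C * K ^ m * \<pi> m"
        by (rule F)
      also have "\<dots> \<le> C * (K + 1) ^ Suc m * (D ^ Suc m * \<pi> (Suc m))"
      proof (intro mult_mono mult_left_mono D(2))
        have "K ^ m \<le> (K + 1) ^ m" using F by (intro power_mono) auto
        also have "\<dots> \<le> (K + 1) ^ Suc m" using F by (intro power_increasing) auto
        finally show "K ^ m \<le> (K + 1) ^ Suc m" .
      qed (use F pos[of m] in \<open>simp_all add: less_imp_le\<close>)
      finally show ?thesis by (simp add: Suc power_mult_distrib mult_ac)
    qed (use F pos[of 0] in simp)
  qed (use F D in simp_all)
qed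

lemma tame_diff: "tame F \<Longrightarrow> tame G \<Longrightarrow> tame (F - G)"
  using tame_add[OF _ tame_const_mult[of G "- 1"]] by (simp add: fps_const_neg[symmetric] del: fps_const_neg)

lemma tame_geometric: "tame (Abs_fps (\<lambda>n. of_real (r ^ n * \<pi> n)))"
  by (rule tameI[where C = 1 and K = "\<bar>r\<bar>"])
     (simp_all add: norm_mult norm_power pos less_imp_le)

text \<open>Eigenvectors are kept tame because the raising operators multiply by
  \<open>fps_X\<close> and must be iterated.\<close>

definition tame_eigenvalue :: "((nat \<Rightarrow> complex) \<Rightarrow> nat \<Rightarrow> complex) \<Rightarrow> complex \<Rightarrow> bool" where
  "tame_eigenvalue T c \<longleftrightarrow> (\<exists>F. tame F \<and> F \<noteq> 0 \<and> T (fps_nth F) = (\<lambda>i. c * fps_nth F i))"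

lemma tame_eigenvalue_imp_eigenvalue:
  assumes "tame_eigenvalue T c"
  shows "c \<in> eigenvalues_on_l2 \<pi> T"
proof -
  obtain F where F: "tame F" "F \<noteq> 0" "T (fps_nth F) = (\<lambda>i. c * fps_nth F i)"
    using assms unfolding tame_eigenvalue_def by blast
  then have "fps_nth F \<noteq> (\<lambda>i. 0)" by (simp add: fps_eq_iff fun_eq_iff)
  with F(3) show ?thesis
    unfolding eigenvalues_on_l2_def using tame_in_l2[OF F(1)] by blast
qed

lemma tame_eigenvalue_power:
  assumes "\<And>c. tame_eigenvalue T c \<Longrightarrow> tame_eigenvalue T (a * c)" "tame_eigenvalue T c"
  shows "tame_eigenvalue T (a ^ k * c)"
  by (induction k) (simp_all add: assms mult.assoc)

lemma tame_eigenvalue_geometric: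
  assumes rev: "\<And>i. \<pi> i * u i = \<pi> (Suc i) * l (Suc i)" and "l 0 = 0"
    and r: "r \<noteq> 0" "\<And>i. l i / r + d i + r * u i = c"
  shows "tame_eigenvalue (right_mult (tridiag u d l)) (of_real c)"
  unfolding tame_eigenvalue_def
proof (intro exI conjI)
  let ?F = "Abs_fps (\<lambda>n. complex_of_real (r ^ n * \<pi> n))"
  show "tame ?F" by (rule tame_geometric)
  have "fps_nth ?F 0 \<noteq> 0" using pos[of 0] by simp
  then show "?F \<noteq> 0" by (metis fps_zero_nth)
  show "right_mult (tridiag u d l) (fps_nth ?F) = (\<lambda>i. of_real c * fps_nth ?F i)"
    unfolding fps_nth_Abs_fps_eta
    by (rule eigenvector_tridiag_geometric; (rule assms | simp))
qed

text \<open>The terms of a convergent series tend to 0, and a nonnegative increasing sequence with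
  limit 0 vanishes. The subsequence \<open>s\<close> allows an argument along odd indices
  only.\<close>

lemma l2_eq_0_of_increasing:
  assumes "\<mu> \<in> l2 \<pi>" and s: "strict_mono s"
    and inc: "\<And>m. (cmod (\<mu> (s m)))\<^sup>2 / \<pi> (s m) \<le> (cmod (\<mu> (s (Suc m))))\<^sup>2 / \<pi> (s (Suc m))"
  shows "\<mu> (s 0) = 0"
proof -
  define v where "v = (\<lambda>n. (cmod (\<mu> n))\<^sup>2 / \<pi> n)"
  have "(v \<circ> s) \<longlonglongrightarrow> 0"
    using l2_tendsto_0[OF assms(1)] s unfolding v_def by (rule LIMSEQ_subseq_LIMSEQ)
  moreover have "incseq (v \<circ> s)"
    using inc by (intro incseq_SucI) (simp add: v_def)
  ultimately have "(v \<circ> s) 0 \<le> 0"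
    by (rule incseq_le[rotated])
  then show ?thesis
    using pos[of "s 0"] by (simp add: v_def divide_le_0_iff not_less less_imp_le)
qed

end

subsection \<open>Kernels with linear death rates\<close>

locale linear_kernel = l2_weight +
  fixes x p :: real
  assumes x: "0 < x" "x < 1" and p: "0 < p" "p < 1"
    and rev: "\<pi> i * (x * p ^ i) = \<pi> (Suc i) * (1 - p ^ Suc i)"
begin

abbreviation kernel :: "nat \<Rightarrow> nat \<Rightarrow> real" where
  "kernel \<equiv> tridiag (\<lambda>i. x * p ^ i) (\<lambda>i. (1 - x) * p ^ i) (\<lambda>i. 1 - p ^ i)"

lemma power_p_tendsto_0: "(\<lambda>n. p ^ n) \<longlonglongrightarrow> 0"
  using p by (intro LIMSEQ_power_zero) simp

lemma power_Suc_p_less_1: "p ^ Suc n < 1"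
  by (rule power_Suc_less_one) (use p in simp_all)

text \<open>By detailed balance \<open>\<pi> n * (x * p ^ n)\<close> is at most
  \<open>\<pi> (Suc n)\<close>; the factor of \<open>(x * p) ^ Suc n\<close> that remains is
  \<open>x ^ n * p\<close>, at most 1.\<close>

sublocale rapid_weight \<pi> "1 / (x * p)"
proof
  have "\<pi> (Suc n) / \<pi> n = x * p ^ n / (1 - p ^ Suc n)" for n
    using rev[of n] pos[of n] power_Suc_p_less_1[of n] by (simp add: field_simps)
  moreover have "(\<lambda>n. x * p ^ n / (1 - p ^ Suc n)) \<longlonglongrightarrow> x * 0 / (1 - 0)"
    by (intro tendsto_intros power_p_tendsto_0 LIMSEQ_Suc[OF power_p_tendsto_0]) simp
  ultimately show "(\<lambda>n. \<pi> (Suc n) / \<pi> n) \<longlonglongrightarrow> 0"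
    by simp
  show "0 \<le> 1 / (x * p)" using x p by simp
  fix n
  have "(x * p) ^ Suc n * \<pi> n = (x ^ n * p) * (\<pi> n * (x * p ^ n))"
    by (simp add: power_mult_distrib)
  also have "\<dots> \<le> 1 * (\<pi> n * (x * p ^ n))"
    using x p pos[of n] by (intro mult_right_mono mult_le_one power_le_one) simp_all
  also have "\<dots> \<le> \<pi> (Suc n)"
    using p pos[of "Suc n"] unfolding rev by (simp add: mult_left_le)
  finally show "\<pi> n \<le> (1 / (x * p)) ^ Suc n * \<pi> (Suc n)"
    using x p by (simp add: power_one_over pos_le_divide_eq mult.commute)
qed

lemma compact_kernel: "compact_operator_on_l2 \<pi> (right_mult kernel)"
proof (rule compact_operator_tridiag[OF rev])
  have "(\<lambda>i. x * p ^ i * (1 - p ^ Suc i)) \<longlonglongrightarrow> x * 0 * (1 - 0)"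
    by (intro tendsto_intros power_p_tendsto_0 LIMSEQ_Suc[OF power_p_tendsto_0])
  then show "(\<lambda>i. x * p ^ i * (1 - p ^ Suc i)) \<longlonglongrightarrow> 0" by simp
  have "(\<lambda>i. (1 - x) * p ^ i) \<longlonglongrightarrow> (1 - x) * 0"
    by (intro tendsto_intros power_p_tendsto_0)
  then show "(\<lambda>i. (1 - x) * p ^ i) \<longlonglongrightarrow> 0" by simp
qed

text \<open>All rates are affine in \<open>p ^ n\<close>, so only F(z) and F(pz) occur; the
  coefficients of F(pz) collect to \<open>1 - (1 - x) z - x z^2 = (1 - z) (1 + x z)\<close>.\<close>

lemma eigen_iff:
  "right_mult kernel (fps_nth F) = (\<lambda>i. c * fps_nth F i) \<longleftrightarrow>
    (1 - fps_const c * fps_X) * F = (1 - fps_X) * (1 + fps_const (of_real x) * fps_X) * fps_scale (of_real p) F"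
proof -
  let ?S = "fps_scale (of_real p) F" and ?T = "Abs_fps (right_mult kernel (fps_nth F))"
  have l: "Abs_fps (\<lambda>n. of_real (1 - p ^ n) * fps_nth F n) = F - ?S"
    by (simp add: fps_eq_iff algebra_simps)
  have d: "Abs_fps (\<lambda>n. of_real ((1 - x) * p ^ n) * fps_nth F n) = ?S - fps_const (of_real x) * ?S"
    by (simp add: fps_eq_iff algebra_simps)
  have u: "Abs_fps (\<lambda>n. of_real (x * p ^ n) * fps_nth F n) = fps_const (of_real x) * ?S"
    by (simp add: fps_eq_iff)
  have T: "fps_X * ?T = F - ?S + fps_X * (?S - fps_const (of_real x) * ?S) + fps_X * (fps_X * (fps_const (of_real x) * ?S))"
    by (subst fps_X_mult_right_mult_tridiag) (simp, simp only: l d u)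
  have "right_mult kernel (fps_nth F) = (\<lambda>i. c * fps_nth F i) \<longleftrightarrow> ?T = fps_const c * F"
    by (simp add: fps_eq_iff fun_eq_iff)
  also have "\<dots> \<longleftrightarrow> fps_X * ?T = fps_X * (fps_const c * F)"
    by simp
  also have "\<dots> \<longleftrightarrow> fps_X * ?T - fps_X * (fps_const c * F) = 0"
    by simp
  also have "fps_X * ?T - fps_X * (fps_const c * F) =
      (1 - fps_const c * fps_X) * F - (1 - fps_X) * (1 + fps_const (of_real x) * fps_X) * ?S"
    unfolding T by (simp add: algebra_simps)
  finally show ?thesis by simp
qed

text \<open>With G = (1 - cz) F = Q(z) F(pz), dilation gives G(pz) = (1 - pcz) F(pz). Multiplying by
  Q yields the eigenvalue equation of G for \<open>p * c\<close>.\<close>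

lemma eigen_raise:
  assumes "right_mult kernel (fps_nth F) = (\<lambda>i. c * fps_nth F i)"
  shows "right_mult kernel (fps_nth ((1 - fps_const c * fps_X) * F)) =
    (\<lambda>i. (of_real p * c) * fps_nth ((1 - fps_const c * fps_X) * F) i)"
proof -
  let ?G = "(1 - fps_const c * fps_X) * F"
    and ?Q = "(1 - fps_X) * (1 + fps_const (of_real x) * fps_X) :: complex fps"
  have G: "?G = ?Q * fps_scale (of_real p) F"
    using assms unfolding eigen_iff .
  have "fps_scale (of_real p) ?G = (1 - fps_const (of_real p * c) * fps_X) * fps_scale (of_real p) F"
    by (simp add: fps_scale_simps fps_const_mult[symmetric] mult_ac del: fps_const_mult)
  then have "?Q * fps_scale (of_real p) ?G =
      (1 - fps_const (of_real p * c) * fps_X) * (?Q * fps_scale (of_real p) F)"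
    by (simp only: mult_ac)
  then show ?thesis
    unfolding eigen_iff G[symmetric] by simp
qed

lemma tame_eigenvalue_raise:
  assumes "tame_eigenvalue (right_mult kernel) c"
  shows "tame_eigenvalue (right_mult kernel) (of_real p * c)"
proof -
  obtain F where F: "tame F" "F \<noteq> 0" "right_mult kernel (fps_nth F) = (\<lambda>i. c * fps_nth F i)"
    using assms unfolding tame_eigenvalue_def by blast
  let ?R = "1 - fps_const c * fps_X"
  have "tame (?R * F)"
    using tame_diff[OF F(1) tame_const_mult[OF tame_X_mult[OF F(1)]]] by (simp add: left_diff_distrib mult.assoc)
  moreover have "fps_nth ?R 0 \<noteq> 0" by simp
  then have "?R \<noteq> 0" by (metis fps_zero_nth)
  then have "?R * F \<noteq> 0" using F(2) by simp
  ultimately show ?thesis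
    using eigen_raise[OF F(3)] unfolding tame_eigenvalue_def by blast
qed

lemma eigenvalue_cases:
  assumes "c \<in> eigenvalues_on_l2 \<pi> (right_mult kernel)" "c \<noteq> 0"
  shows "\<exists>k. c = of_real p ^ k \<or> c = - of_real x * of_real p ^ k"
proof (rule ccontr)
  assume nex: "\<not> ?thesis"
  obtain \<mu> where \<mu>: "\<mu> \<in> l2 \<pi>" "\<mu> \<noteq> (\<lambda>i. 0)" and eig: "right_mult kernel \<mu> = (\<lambda>i. c * \<mu> i)"
    using assms(1) unfolding eigenvalues_on_l2_def by blast
  define F where "F = Abs_fps \<mu>"
  have ent: "fps_conv_radius F = \<infinity>"
    unfolding F_def by (rule fps_conv_radius_l2[OF \<mu>(1)])
  note entS = fps_conv_radius_scale_infty[OF ent]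
  have eq: "(1 - fps_const c * fps_X) * F =
      (1 - fps_X) * (1 + fps_const (of_real x) * fps_X) * fps_scale (of_real p) F"
    using eig eigen_iff[of F c] by (simp add: F_def)
  have func: "(1 - c * z) * eval_fps F z = (1 - z) * (1 + of_real x * z) * eval_fps F (of_real p * z)" for z
    using arg_cong[OF eq, of "\<lambda>f. eval_fps f z"]
    by (simp add: eval_fps_mult eval_fps_diff eval_fps_add eval_fps_scale ent entS)
  \<comment> \<open>At \<open>z = p ^ n / c\<close> the left factor \<open>1 - c * z\<close> is
    \<open>1 - p ^ n\<close>. It vanishes for \<open>n = 0\<close>, which starts the induction; the
    two factors on the right are nonzero by the choice of \<open>c\<close>.\<close>
  have step: "(1 - p ^ n) * eval_fps F (p ^ n / c) = 0 \<Longrightarrow> eval_fps F (p ^ Suc n / c) = 0" for n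
  proof -
    assume 0: "(1 - p ^ n) * eval_fps F (p ^ n / c) = 0"
    have "1 - of_real p ^ n / c \<noteq> 0"
      using nex assms(2) by (auto simp: field_simps)
    moreover have "1 + of_real x * (of_real p ^ n / c) \<noteq> 0"
    proof
      assume "1 + of_real x * (of_real p ^ n / c) = 0"
      then have "c + of_real x * of_real p ^ n = 0"
        using assms(2) by (simp add: field_simps)
      then have "c = - of_real x * of_real p ^ n"
        by (simp add: eq_neg_iff_add_eq_0)
      with nex show False by blast
    qed
    ultimately show "eval_fps F (p ^ Suc n / c) = 0"
      using func[of "p ^ n / c"] 0 assms(2) by simp
  qed
  have zeros: "eval_fps F (of_real p ^ Suc n * (1 / c)) = 0" for n
  proof (induction n)
    case 0 show ?case using step[of 0] by simp
  next
    case (Suc n)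
    then show ?case using step[of "Suc n"] by simp
  qed
  have "fps_nth F 0 = 0"
    by (rule fps_nth_0_eq_0_of_zeros[OF ent _ zeros]) (use p in simp)
  then have "\<mu> 0 = 0" by (simp add: F_def)
  moreover have "1 - p ^ Suc n \<noteq> 0" for n
    using power_Suc_p_less_1[of n] by simp
  ultimately show False
    using eigenvector_tridiag_eq_0[OF _ eig] \<mu>(2) by blast
qed

lemma eigenvalues_kernel:
  assumes "0 \<notin> eigenvalues_on_l2 \<pi> (right_mult kernel)"
  shows "eigenvalues_on_l2 \<pi> (right_mult kernel) =
    range (\<lambda>k. of_real p ^ k) \<union> range (\<lambda>k. - of_real x * of_real p ^ k)"
proof (intro equalityI subsetI)
  fix c assume "c \<in> eigenvalues_on_l2 \<pi> (right_mult kernel)"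
  with assms eigenvalue_cases[OF this] show "c \<in> range (\<lambda>k. of_real p ^ k) \<union> range (\<lambda>k. - of_real x * of_real p ^ k)"
    by auto
next
  fix c :: complex assume "c \<in> range (\<lambda>k. of_real p ^ k) \<union> range (\<lambda>k. - of_real x * of_real p ^ k)"
  then consider k where "c = of_real p ^ k * of_real 1" | k where "c = of_real p ^ k * of_real (- x)"
    by (auto simp: mult.commute)
  then show "c \<in> eigenvalues_on_l2 \<pi> (right_mult kernel)"
  proof cases
    case 1
    have "tame_eigenvalue (right_mult kernel) (of_real 1)"
      by (rule tame_eigenvalue_geometric[of _ _ 1]; (rule rev | simp add: algebra_simps))
    then show ?thesis unfolding 1
      by (intro tame_eigenvalue_imp_eigenvalue tame_eigenvalue_power tame_eigenvalue_raise)
  next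
    case 2
    \<comment> \<open>For \<open>r = - 1 / x\<close> the terms in \<open>p ^ i\<close> cancel:
      \<open>- x * (1 - p ^ i) + (1 - x) * p ^ i - p ^ i = - x\<close>.\<close>
    have "tame_eigenvalue (right_mult kernel) (of_real (- x))"
      by (rule tame_eigenvalue_geometric[of _ _ "- 1 / x"]; (rule rev | use x in \<open>simp add: field_simps\<close>))
    then show ?thesis unfolding 2
      by (intro tame_eigenvalue_imp_eigenvalue tame_eigenvalue_power tame_eigenvalue_raise)
  qed
qed

text \<open>For \<open>p = x\<close> the equation F(z) = (1 - z) (1 + xz) F(xz) makes F the product
  of 1 - z and an even series. Hence entries \<open>2 * m\<close> and \<open>2 * m + 1\<close> are
  opposite, and the growth argument runs along odd indices.\<close>

lemma zero_not_eigenvalue_linear: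
  assumes "p = x"
  shows "0 \<notin> eigenvalues_on_l2 \<pi> (right_mult kernel)"
proof
  assume "0 \<in> eigenvalues_on_l2 \<pi> (right_mult kernel)"
  then obtain \<mu> where \<mu>: "\<mu> \<in> l2 \<pi>" "\<mu> \<noteq> (\<lambda>i. 0)" and eig: "right_mult kernel \<mu> = (\<lambda>i. 0 * \<mu> i)"
    unfolding eigenvalues_on_l2_def by blast
  have l0: "1 - x ^ Suc n > 0" for n
    using power_Suc_p_less_1[of n] by (simp add: assms)
  have l0c: "1 - complex_of_real x ^ Suc n \<noteq> 0" for n
    using l0[of n] by (metis less_irrefl of_real_0 of_real_1 of_real_diff of_real_eq_iff of_real_power)
  have rec0: "(1 - of_real x) * \<mu> 0 + (1 - of_real x) * \<mu> 1 = 0"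
    using fun_cong[OF eig, of 0] by (simp add: right_mult_tridiag assms mult.commute)
  have rec: "(1 - of_real x ^ Suc (Suc n)) * \<mu> (Suc (Suc n)) =
      - (1 - of_real x) * of_real x ^ Suc n * \<mu> (Suc n) - of_real x ^ Suc n * \<mu> n" for n
    using fun_cong[OF eig, of "Suc n"]
    by (simp add: right_mult_tridiag assms algebra_simps add_eq_0_iff)
  have odd: "\<mu> (2 * m + 1) = - \<mu> (2 * m)" for m
  proof (induction m)
    case 0
    have "(1 - complex_of_real x) * (\<mu> 1 + \<mu> 0) = 0"
      unfolding distrib_left using rec0 by (simp only: add.commute)
    then show ?case using l0c[of 0] by (simp add: add_eq_0_iff)
  next
    case (Suc m)
    define e where "e = complex_of_real x ^ (2 * m + 2)"
    let ?A = "\<mu> (2 * m)" and ?B = "\<mu> (2 * m + 2)" and ?C = "\<mu> (2 * m + 3)"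
    have r1: "(1 - e) * ?B = - (e * ?A)"
      using rec[of "2 * m"] Suc by (simp add: e_def algebra_simps)
    have r2: "(1 - of_real x * e) * ?C = (of_real x - 1) * e * ?B + e * ?A"
      using rec[of "2 * m + 1"] Suc by (simp add: e_def numeral_3_eq_3)
    \<comment> \<open>Splits \<open>(1 - x * e) * ?B\<close> as
      \<open>(1 - e) * ?B + (1 - x) * e * ?B\<close>, so that \<open>r1\<close> and
      \<open>r2\<close> apply.\<close>
    have "(1 - of_real x * e) * (?C + ?B) =
        ((1 - of_real x * e) * ?C + (1 - of_real x) * e * ?B - e * ?A) + ((1 - e) * ?B + e * ?A)"
      by (simp add: algebra_simps)
    also have "\<dots> = 0"
      unfolding r1 r2 by (simp add: algebra_simps)
    finally have "(1 - of_real x ^ (2 * m + 3)) * (?C + ?B) = 0"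
      by (simp add: e_def numeral_3_eq_3)
    moreover have "1 - complex_of_real x ^ (2 * m + 3) \<noteq> 0"
      using l0c[of "2 * m + 2"] by (simp add: numeral_3_eq_3)
    ultimately show ?case by (simp add: add_eq_0_iff numeral_3_eq_3)
  qed
  have "\<mu> (2 * 0 + 1) = 0"
  proof (rule l2_eq_0_of_increasing[OF \<mu>(1)])
    show "strict_mono (\<lambda>m::nat. 2 * m + 1)" by (simp add: strict_mono_def)
    fix m
    define a where "a = x ^ (2 * m + 2)"
    have a: "0 < a" "a < 1" using x l0[of "2 * m + 1"] by (simp_all add: a_def)
    have ax: "a * x < 1" using a x mult_strict_mono[of a 1 x 1] by simp
    have "(1 - of_real x ^ (2 * m + 2)) * \<mu> (2 * m + 2) = of_real x ^ (2 * m + 2) * \<mu> (2 * m + 1)"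
      using rec[of "2 * m"] odd[of m] by (simp add: algebra_simps)
    then have "complex_of_real (1 - a) * \<mu> (2 * Suc m + 1) = - of_real a * \<mu> (2 * m + 1)"
      using odd[of "Suc m"] by (simp add: a_def)
    then have "cmod (complex_of_real (1 - a) * \<mu> (2 * Suc m + 1)) = cmod (- of_real a * \<mu> (2 * m + 1))"
      by (rule arg_cong)
    then have eq: "cmod (\<mu> (2 * Suc m + 1)) = a / (1 - a) * cmod (\<mu> (2 * m + 1))"
      using a by (simp add: norm_mult field_simps del: of_real_diff)
    have p1: "\<pi> (2 * m + 1) * a = \<pi> (2 * m + 2) * (1 - a)"
      using rev[of "2 * m + 1"] by (simp add: assms a_def mult_ac)
    have p2: "\<pi> (2 * m + 2) * (x * a) = \<pi> (2 * m + 3) * (1 - a * x)"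
      using rev[of "2 * m + 2"] by (simp add: assms a_def mult_ac numeral_3_eq_3)
    have pi3: "\<pi> (2 * Suc m + 1) = \<pi> (2 * m + 1) * (x * a\<^sup>2 / ((1 - a) * (1 - a * x)))"
    proof -
      have "\<pi> (2 * m + 3) = \<pi> (2 * m + 2) * (x * a) / (1 - a * x)" using p2 ax by (simp add: field_simps)
      moreover have "\<pi> (2 * m + 2) = \<pi> (2 * m + 1) * a / (1 - a)" using p1 a by (simp add: field_simps)
      ultimately show ?thesis by (simp add: power2_eq_square numeral_3_eq_3)
    qed
    \<comment> \<open>Here \<open>d = 1 - a\<close> and \<open>e = 1 - a * x\<close>; the condition
      \<open>x * d \<le> e\<close> reduces to \<open>x \<le> 1\<close>.\<close>
    show "(cmod (\<mu> (2 * m + 1)))\<^sup>2 / \<pi> (2 * m + 1) \<le> (cmod (\<mu> (2 * Suc m + 1)))\<^sup>2 / \<pi> (2 * Suc m + 1)"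
      unfolding eq pi3 using a x pos[of "2 * m + 1"]
      by (intro weighted_square_step) (simp_all add: algebra_simps)
  qed
  then have "\<mu> 0 = 0" using odd[of 0] by simp
  moreover have "1 - p ^ Suc n \<noteq> 0" for n
    using power_Suc_p_less_1[of n] by simp
  ultimately show False
    using eigenvector_tridiag_eq_0[OF _ eig] \<mu>(2) by blast
qed

text \<open>For \<open>p = x\<^sup>2\<close> the operator in the equation is the square of F(z) ->
  (1 - z) F(-xz). A kernel vector must be fixed by the latter, which gives a one-step
  recurrence.\<close>

lemma zero_not_eigenvalue_quadratic:
  assumes "p = x\<^sup>2" "x \<le> 1 / 3"
  shows "0 \<notin> eigenvalues_on_l2 \<pi> (right_mult kernel)"
proof
  assume "0 \<in> eigenvalues_on_l2 \<pi> (right_mult kernel)"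
  then obtain \<mu> where \<mu>: "\<mu> \<in> l2 \<pi>" "\<mu> \<noteq> (\<lambda>i. 0)" and eig: "right_mult kernel \<mu> = (\<lambda>i. 0 * \<mu> i)"
    unfolding eigenvalues_on_l2_def by blast
  have p1: "1 - p ^ Suc n > 0" for n
    using power_Suc_p_less_1[of n] by simp
  define F where "F = Abs_fps \<mu>"
  \<comment> \<open>The equation \<open>F(z) = (1 - z) (1 + x z) F(x\<^sup>2 z)\<close> is two iterations of \<open>F(z) = (1 - z) F(- x z)\<close>.\<close>
  define y where "y = - complex_of_real x"
  have yy: "y * y = of_real p" by (simp add: y_def assms power2_eq_square)
  have xy: "fps_const (complex_of_real x) = - fps_const y" by (simp add: y_def)
  have F: "F = (1 - fps_X) * (1 - fps_const y * fps_X) * fps_scale (y * y) F"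
    using eig eigen_iff[of F 0] by (simp add: F_def xy yy del: fps_const_neg)
  \<comment> \<open>\<open>H\<close> is the defect in the half-step equation. It has constant term 0
    and is negated by the half-step operator, so its coefficients vanish one after another.\<close>
  define H where "H = F - (1 - fps_X) * fps_scale y F"
  have "(1 - fps_X) * fps_scale y H = (1 - fps_X) * fps_scale y F
      - (1 - fps_X) * (1 - fps_const y * fps_X) * fps_scale (y * y) F"
    by (simp add: H_def fps_scale_simps algebra_simps)
  then have HS: "H = - ((1 - fps_X) * fps_scale y H)"
    using F by (simp add: H_def)
  have yn: "cmod (y ^ Suc n) < 1" for n
    using power_Suc_less_one[of x n] x by (simp add: y_def norm_mult norm_power)
  have "fps_nth H n = 0" for n
  proof (induction n)
    case 0 show ?case by (simp add: H_def)
  next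
    case (Suc n)
    have "fps_nth H (Suc n) = - (y ^ Suc n * fps_nth H (Suc n)) + y ^ n * fps_nth H n"
      using arg_cong[OF HS, of "\<lambda>f. fps_nth f (Suc n)"] by (simp add: left_diff_distrib)
    then have "fps_nth H (Suc n) = - (y ^ Suc n * fps_nth H (Suc n))"
      using Suc by simp
    then have "(1 + y ^ Suc n) * fps_nth H (Suc n) = 0"
      by (simp only: eq_neg_iff_add_eq_0 distrib_right mult_1)
    moreover have "1 + y ^ Suc n \<noteq> 0"
      using yn[of n] by (metis add_eq_0_iff less_irrefl norm_minus_cancel norm_one)
    ultimately show ?case by simp
  qed
  then have FS: "F = (1 - fps_X) * fps_scale y F"
    by (simp add: H_def fps_eq_iff)
  have rec: "(1 - y ^ Suc n) * \<mu> (Suc n) = - (y ^ n) * \<mu> n" for n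
    using arg_cong[OF FS, of "\<lambda>f. fps_nth f (Suc n)"] by (simp add: left_diff_distrib F_def algebra_simps)
  have "\<mu> (id 0) = 0"
  proof (rule l2_eq_0_of_increasing[OF \<mu>(1)])
    show "strict_mono (id :: nat \<Rightarrow> nat)" by (simp add: strict_mono_def)
    fix m
    \<comment> \<open>\<open>b\<close> is the real value of \<open>y ^ Suc m\<close>, and
      \<open>1 - p ^ Suc m = (1 - b) * (1 + b)\<close>.\<close>
    define b where "b = (- x) ^ Suc m"
    have xm: "x ^ m \<le> 1" "0 < x ^ m" using x by (simp_all add: power_le_one)
    have "\<bar>b\<bar> = x * x ^ m" using x by (simp add: b_def abs_mult power_abs)
    also have "\<dots> \<le> x * 1" using x xm by (intro mult_left_mono) auto
    finally have "\<bar>b\<bar> \<le> x" by simp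
    then have b: "- x \<le> b" "b \<le> x" "b < 1" "b > - 1" using x by auto
    have yb: "y ^ Suc m = of_real b" by (simp add: y_def b_def)
    have "b\<^sup>2 = ((- x)\<^sup>2) ^ Suc m"
      unfolding b_def power_mult[symmetric] by (simp only: mult.commute)
    then have pb: "p ^ Suc m = b\<^sup>2" by (simp only: assms power2_minus)
    have "cmod ((1 - y ^ Suc m) * \<mu> (Suc m)) = cmod (- (y ^ m) * \<mu> m)"
      by (simp only: rec)
    moreover have "cmod (1 - y ^ Suc m) = 1 - b"
      unfolding yb using b by (metis abs_of_pos diff_gt_0_iff_gt norm_of_real of_real_1 of_real_diff)
    moreover have "cmod (y ^ m) = x ^ m" using x by (simp add: y_def norm_power)
    ultimately have "(1 - b) * cmod (\<mu> (Suc m)) = x ^ m * cmod (\<mu> m)"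
      by (simp add: norm_mult)
    then have eq: "cmod (\<mu> (Suc m)) = x ^ m / (1 - b) * cmod (\<mu> m)"
      using b by (simp add: field_simps)
    have pim: "\<pi> (Suc m) = \<pi> m * (x * (x ^ m)\<^sup>2 / ((1 - b) * (1 + b)))"
    proof -
      have nz: "(1 - b) * (1 + b) \<noteq> 0" using b by simp
      have "\<pi> m * (x * (x ^ m)\<^sup>2) = \<pi> (Suc m) * (1 - b\<^sup>2)"
        using rev[of m] unfolding pb by (simp add: assms power_mult[symmetric] mult.commute)
      moreover have "1 - b\<^sup>2 = (1 - b) * (1 + b)" by (simp add: power2_eq_square algebra_simps)
      ultimately show ?thesis
        by (simp only: nonzero_eq_divide_eq[OF nz] times_divide_eq_right)
    qed
    \<comment> \<open>The sign of \<open>b\<close> alternates, so \<open>1 + b\<close> may be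
      smaller than \<open>1 - b\<close>; \<open>b \<ge> - 1 / 3\<close> still gives
      \<open>(1 - b) / 3 \<le> 1 + b\<close>.\<close>
    have "x * (1 - b) \<le> 1 / 3 * (1 - b)" using assms(2) b by (intro mult_right_mono) auto
    also have "\<dots> \<le> 1 + b" using b assms(2) by (simp add: field_simps)
    finally have "(cmod (\<mu> m))\<^sup>2 / \<pi> m \<le> (cmod (\<mu> (Suc m)))\<^sup>2 / \<pi> (Suc m)"
      unfolding eq pim using b x xm pos[of m] by (intro weighted_square_step) simp_all
    then show "(cmod (\<mu> (id m)))\<^sup>2 / \<pi> (id m) \<le> (cmod (\<mu> (id (Suc m))))\<^sup>2 / \<pi> (id (Suc m))"
      by simp
  qed
  then have "\<mu> 0 = 0" by simp
  moreover have "1 - p ^ Suc n \<noteq> 0" for n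
    using p1[of n] by simp
  ultimately show False
    using eigenvector_tridiag_eq_0[OF _ eig] \<mu>(2) by blast
qed

end

subsection \<open>Kernels with quadratic death rates\<close>

locale quadratic_kernel = l2_weight +
  fixes y p :: real
  assumes y: "0 < y" "y * p < 1" and p: "0 < p" "p < 1"
    and rev: "\<pi> i * (y * p ^ (2 * i + 1)) = \<pi> (Suc i) * ((1 - p ^ Suc i) * (1 - y * p ^ Suc i))"
begin

abbreviation kernel :: "nat \<Rightarrow> nat \<Rightarrow> real" where
  "kernel \<equiv> tridiag (\<lambda>i. y * p ^ (2 * i + 1))
    (\<lambda>i. 1 - y * p ^ (2 * i + 1) - (1 - p ^ i) * (1 - y * p ^ i))
    (\<lambda>i. (1 - p ^ i) * (1 - y * p ^ i))"

lemma power_p_tendsto_0: "(\<lambda>n. p ^ n) \<longlonglongrightarrow> 0"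
  using p by (intro LIMSEQ_power_zero) simp

lemma power_Suc_p: "0 < p ^ Suc n" "p ^ Suc n < 1" "0 < y * p ^ Suc n" "y * p ^ Suc n < 1"
proof -
  show "0 < p ^ Suc n" "0 < y * p ^ Suc n" using p y by simp_all
  show "p ^ Suc n < 1" by (rule power_Suc_less_one) (use p in simp_all)
  have "y * p ^ Suc n = (y * p) * p ^ n" by simp
  also have "\<dots> \<le> (y * p) * 1" using y p by (intro mult_left_mono power_le_one) simp_all
  also have "\<dots> < 1" using y by simp
  finally show "y * p ^ Suc n < 1" .
qed

lemma l_Suc: "0 < (1 - p ^ Suc n) * (1 - y * p ^ Suc n)" "(1 - p ^ Suc n) * (1 - y * p ^ Suc n) \<le> 1"
proof -
  show "0 < (1 - p ^ Suc n) * (1 - y * p ^ Suc n)"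
    using power_Suc_p[of n] by (intro mult_pos_pos) linarith+
  show "(1 - p ^ Suc n) * (1 - y * p ^ Suc n) \<le> 1"
    using power_Suc_p[of n] by (intro mult_le_one) linarith+
qed

lemma l_Suc_tendsto: "(\<lambda>n. (1 - p ^ Suc n) * (1 - y * p ^ Suc n)) \<longlonglongrightarrow> 1"
proof -
  have "(\<lambda>n. (1 - p ^ Suc n) * (1 - y * p ^ Suc n)) \<longlonglongrightarrow> (1 - 0) * (1 - y * 0)"
    by (intro tendsto_intros LIMSEQ_Suc[OF power_p_tendsto_0])
  then show ?thesis by simp
qed

lemma u_tendsto: "(\<lambda>n. y * p ^ (2 * n + 1)) \<longlonglongrightarrow> 0"
proof -
  have "(\<lambda>n. y * (p * (p ^ n)\<^sup>2)) \<longlonglongrightarrow> y * (p * 0\<^sup>2)"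
    by (intro tendsto_intros power_p_tendsto_0)
  moreover have "p ^ (2 * n + 1) = p * (p ^ n)\<^sup>2" for n
    by (simp add: power_mult[symmetric] mult.commute)
  ultimately show ?thesis by (simp only:) simp
qed

sublocale rapid_weight \<pi> "1 / (min 1 y * p\<^sup>2)"
proof
  have "\<pi> (Suc n) / \<pi> n = y * p ^ (2 * n + 1) / ((1 - p ^ Suc n) * (1 - y * p ^ Suc n))" for n
  proof -
    have nz: "\<pi> n \<noteq> 0" "(1 - p ^ Suc n) * (1 - y * p ^ Suc n) \<noteq> 0"
      using pos[of n] l_Suc(1)[of n] by linarith+
    show ?thesis
      unfolding frac_eq_eq[OF nz] rev[symmetric] by (rule mult.commute)
  qed
  moreover have "(\<lambda>n. y * p ^ (2 * n + 1) / ((1 - p ^ Suc n) * (1 - y * p ^ Suc n))) \<longlonglongrightarrow> 0 / 1"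
    by (intro tendsto_divide u_tendsto l_Suc_tendsto) simp
  ultimately show "(\<lambda>n. \<pi> (Suc n) / \<pi> n) \<longlonglongrightarrow> 0"
    by simp
  \<comment> \<open>The minimum covers \<open>y < 1\<close> and \<open>y > 1\<close> together:
    powers of \<open>m\<close> are at most 1, and \<open>m\<close> itself is at most
    \<open>y\<close>.\<close>
  define m where "m = min 1 y"
  have m: "0 < m" "m \<le> 1" "m \<le> y" using y by (simp_all add: m_def)
  show "0 \<le> 1 / (min 1 y * p\<^sup>2)" using m p by (simp add: m_def)
  fix n
  have "(m * p\<^sup>2) ^ Suc n * \<pi> n = (m ^ n * p) * m * (\<pi> n * p ^ (2 * n + 1))"
    by (simp add: power_mult_distrib power_mult power2_eq_square)
  also have "\<dots> \<le> 1 * y * (\<pi> n * p ^ (2 * n + 1))"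
    using m p y pos[of n] by (intro mult_right_mono mult_mono mult_le_one power_le_one) simp_all
  also have "\<dots> = \<pi> (Suc n) * ((1 - p ^ Suc n) * (1 - y * p ^ Suc n))"
    unfolding rev[symmetric] by simp
  also have "\<dots> \<le> \<pi> (Suc n)"
    using l_Suc[of n] pos[of "Suc n"] by (intro mult_left_le) simp_all
  finally show "\<pi> n \<le> (1 / (min 1 y * p\<^sup>2)) ^ Suc n * \<pi> (Suc n)"
    unfolding m_def[symmetric] using m p by (simp add: power_one_over pos_le_divide_eq mult.commute)
qed

lemma compact_kernel: "compact_operator_on_l2 \<pi> (right_mult kernel)"
proof (rule compact_operator_tridiag[OF rev])
  have "(\<lambda>i. y * p ^ (2 * i + 1) * ((1 - p ^ Suc i) * (1 - y * p ^ Suc i))) \<longlonglongrightarrow> 0 * 1"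
    by (intro tendsto_mult u_tendsto l_Suc_tendsto)
  then show "(\<lambda>i. y * p ^ (2 * i + 1) * ((1 - p ^ Suc i) * (1 - y * p ^ Suc i))) \<longlonglongrightarrow> 0" by simp
  have "(\<lambda>i. 1 - y * p ^ (2 * i + 1) - (1 - p ^ i) * (1 - y * p ^ i)) \<longlonglongrightarrow> 1 - 0 - (1 - 0) * (1 - y * 0)"
    by (intro tendsto_diff tendsto_mult u_tendsto power_p_tendsto_0 tendsto_const)
  then show "(\<lambda>i. 1 - y * p ^ (2 * i + 1) - (1 - p ^ i) * (1 - y * p ^ i)) \<longlonglongrightarrow> 0" by simp
qed

text \<open>The death rate \<open>1 - (1 + y) * p ^ n + y * p ^ (2 * n)\<close> is quadratic in
  \<open>p ^ n\<close>, which brings in a second dilation.\<close>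

lemma eigen_iff:
  "right_mult kernel (fps_nth F) = (\<lambda>i. c * fps_nth F i) \<longleftrightarrow>
    (1 - fps_const c * fps_X) * F - (1 + fps_const (of_real y)) * (1 - fps_X) * fps_scale (of_real p) F
      + fps_const (of_real y) * (1 - fps_X) * (1 - fps_const (of_real p) * fps_X)
        * fps_scale (of_real p) (fps_scale (of_real p) F) = 0" (is "_ \<longleftrightarrow> ?E = 0")
proof -
  let ?S = "fps_scale (of_real p) F" and ?T = "Abs_fps (right_mult kernel (fps_nth F))"
  let ?SS = "fps_scale (of_real p) ?S" and ?y = "fps_const (complex_of_real y)" and ?p = "fps_const (complex_of_real p)"
  have l: "Abs_fps (\<lambda>n. of_real ((1 - p ^ n) * (1 - y * p ^ n)) * fps_nth F n) = F - (1 + ?y) * ?S + ?y * ?SS"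
    by (simp add: fps_eq_iff algebra_simps)
  have u: "Abs_fps (\<lambda>n. of_real (y * p ^ (2 * n + 1)) * fps_nth F n) = ?y * ?p * ?SS"
    by (simp add: fps_eq_iff power_mult power2_eq_square power_mult_distrib)
  have d: "Abs_fps (\<lambda>n. of_real (1 - y * p ^ (2 * n + 1) - (1 - p ^ n) * (1 - y * p ^ n)) * fps_nth F n) =
      (1 + ?y) * ?S - ?y * ?SS - ?y * ?p * ?SS"
    unfolding u[symmetric] by (simp add: fps_eq_iff algebra_simps)
  have T: "fps_X * ?T = F - (1 + ?y) * ?S + ?y * ?SS + fps_X * ((1 + ?y) * ?S - ?y * ?SS - ?y * ?p * ?SS)
      + fps_X * (fps_X * (?y * ?p * ?SS))"
    by (subst fps_X_mult_right_mult_tridiag) (simp, simp only: l d u)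
  have "right_mult kernel (fps_nth F) = (\<lambda>i. c * fps_nth F i) \<longleftrightarrow> ?T = fps_const c * F"
    by (simp add: fps_eq_iff fun_eq_iff)
  also have "\<dots> \<longleftrightarrow> fps_X * ?T = fps_X * (fps_const c * F)"
    by simp
  also have "\<dots> \<longleftrightarrow> fps_X * ?T - fps_X * (fps_const c * F) = 0"
    by simp
  also have "fps_X * ?T - fps_X * (fps_const c * F) = ?E"
    unfolding T by (simp add: algebra_simps del: fps_scale_scale)
  finally show ?thesis .
qed

text \<open>Dilating the equation of F by \<open>p\<close> and multiplying it by 1 - z gives exactly
  the equation of (1 - z) F(pz) for \<open>p * c\<close>.\<close>

lemma tame_eigenvalue_raise:
  assumes "tame_eigenvalue (right_mult kernel) c"
  shows "tame_eigenvalue (right_mult kernel) (of_real p * c)"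
proof -
  obtain F where F: "tame F" "F \<noteq> 0" and eig: "right_mult kernel (fps_nth F) = (\<lambda>i. c * fps_nth F i)"
    using assms unfolding tame_eigenvalue_def by blast
  let ?S = "fps_scale (complex_of_real p)" and ?y = "fps_const (complex_of_real y)" and ?p = "fps_const (complex_of_real p)"
  let ?G = "(1 - fps_X) * ?S F"
  have "tame ?G"
    using tame_diff[OF tame_scale[OF F(1)] tame_X_mult[OF tame_scale[OF F(1)]]] by (simp add: left_diff_distrib)
  moreover have "?G \<noteq> 0"
  proof -
    have "?S F \<noteq> 0" using F(2) p by (simp add: fps_eq_iff)
    moreover have "1 - fps_X \<noteq> (0 :: complex fps)"
      by (metis diff_zero fps_X_nth fps_one_nth fps_sub_nth fps_zero_nth zero_neq_one)
    ultimately show ?thesis by simp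
  qed
  moreover have "right_mult kernel (fps_nth ?G) = (\<lambda>i. (of_real p * c) * fps_nth ?G i)"
    unfolding eigen_iff
  proof -
    let ?E = "(1 - fps_const c * fps_X) * F - (1 + ?y) * (1 - fps_X) * ?S F
      + ?y * (1 - fps_X) * (1 - ?p * fps_X) * ?S (?S F)"
    have "?E = 0" using eig unfolding eigen_iff .
    then have SE: "?S ?E = 0" by (simp only: fps_eq_iff fps_nth_scale fps_zero_nth mult_zero_right) simp
    have "(1 - fps_const (of_real p * c) * fps_X) * ?G - (1 + ?y) * (1 - fps_X) * ?S ?G
      + ?y * (1 - fps_X) * (1 - ?p * fps_X) * ?S (?S ?G) = (1 - fps_X) * ?S ?E"
      by (simp add: fps_scale_simps fps_const_mult[symmetric] algebra_simps del: fps_const_mult fps_scale_scale)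
    also have "\<dots> = 0"
      by (simp only: SE mult_zero_right)
    finally show "(1 - fps_const (of_real p * c) * fps_X) * ?G - (1 + ?y) * (1 - fps_X) * ?S ?G
      + ?y * (1 - fps_X) * (1 - ?p * fps_X) * ?S (?S ?G) = 0" .
  qed
  ultimately show ?thesis
    unfolding tame_eigenvalue_def by blast
qed

lemma one_minus_power_ne_0: "1 - complex_of_real y * of_real p ^ Suc n \<noteq> 0"
proof -
  have "complex_of_real (1 - y * p ^ Suc n) \<noteq> 0"
    unfolding of_real_eq_0_iff using power_Suc_p[of n] by linarith
  then show ?thesis by simp
qed

lemma eigenvector_0_ne_0:
  assumes "right_mult kernel \<mu> = (\<lambda>i. c * \<mu> i)" "\<mu> \<noteq> (\<lambda>i. 0)"
  shows "\<mu> 0 \<noteq> 0"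
proof
  assume "\<mu> 0 = 0"
  moreover have "(1 - p ^ Suc n) * (1 - y * p ^ Suc n) \<noteq> 0" for n
    using l_Suc(1)[of n] by linarith
  ultimately show False
    using eigenvector_tridiag_eq_0[OF _ assms(1)] assms(2) by blast
qed

text \<open>The \<open>q\<close>-exponential series, with zeros \<open>p\<^sup>-\<^sup>k\<close>.\<close>

definition zeros_fps :: "complex fps" where
  "zeros_fps = Abs_fps (\<lambda>n. of_real (\<Prod>j<n. - (p ^ j / (1 - p ^ Suc j))))"

lemma zeros_fps_nth_0 [simp]: "fps_nth zeros_fps 0 = 1"
  by (simp add: zeros_fps_def)

text \<open>In coefficients this is \<open>(1 - p ^ Suc k) * a (Suc k) = - (p ^ k) * a k\<close>,
  the recursion built into the product.\<close>

lemma zeros_fps_eq: "zeros_fps = (1 - fps_X) * fps_scale (of_real p) zeros_fps"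
proof (rule fps_ext)
  fix n
  show "fps_nth zeros_fps n = fps_nth ((1 - fps_X) * fps_scale (of_real p) zeros_fps) n"
  proof (cases n)
    case (Suc k)
    define a where "a = (\<Prod>j<k. - (p ^ j / (1 - p ^ Suc j)))"
    define f where "f = p ^ k / (1 - p ^ Suc k)"
    have f: "p ^ k = f * (1 - p ^ Suc k)"
      using power_Suc_p[of k] by (simp add: f_def)
    have "a * (- f) = p ^ Suc k * (a * (- f)) - f * (1 - p ^ Suc k) * a"
      by (simp add: algebra_simps)
    then have "complex_of_real (a * (- f)) = of_real (p ^ Suc k * (a * (- f)) - p ^ k * a)"
      unfolding f[symmetric] by (rule arg_cong)
    moreover have z: "fps_nth zeros_fps k = of_real a" "fps_nth zeros_fps (Suc k) = of_real (a * (- f))"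
      by (simp_all only: zeros_fps_def fps_nth_Abs_fps a_def f_def prod.lessThan_Suc)
    moreover have "fps_nth ((1 - fps_X) * fps_scale (of_real p) zeros_fps) (Suc k) =
        of_real p ^ Suc k * fps_nth zeros_fps (Suc k) - of_real p ^ k * fps_nth zeros_fps k"
      by (simp add: left_diff_distrib)
    ultimately show ?thesis
      unfolding Suc by (simp only: of_real_diff of_real_mult of_real_power)
  qed simp
qed

lemma fps_conv_radius_zeros_fps: "fps_conv_radius zeros_fps = \<infinity>"
proof (rule fps_conv_radius_infty_of_bound)
  define a where "a = (\<lambda>n. \<Prod>j<n. p ^ j / (1 - p ^ Suc j))"
  have f: "0 < p ^ j / (1 - p ^ Suc j)" for j
    using power_Suc_p[of j] p by (intro divide_pos_pos) simp_all
  show a: "0 < a n" for n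
    unfolding a_def using f by (intro prod_pos) blast
  have "a (Suc n) = a n * (p ^ n / (1 - p ^ Suc n))" for n
    unfolding a_def by (rule prod.lessThan_Suc)
  then have "a (Suc n) / a n = p ^ n / (1 - p ^ Suc n)" for n
    using a[of n] by simp
  moreover have "(\<lambda>n. p ^ n / (1 - p ^ Suc n)) \<longlonglongrightarrow> 0 / (1 - 0)"
    by (intro tendsto_intros power_p_tendsto_0 LIMSEQ_Suc[OF power_p_tendsto_0]) simp
  ultimately show "(\<lambda>n. a (Suc n) / a n) \<longlonglongrightarrow> 0" by simp
  fix n
  have "\<bar>\<Prod>j<n. - (p ^ j / (1 - p ^ Suc j))\<bar> = (\<Prod>j<n. \<bar>- (p ^ j / (1 - p ^ Suc j))\<bar>)"
    by (rule abs_prod)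
  also have "\<dots> = a n"
    unfolding a_def abs_minus_cancel using f by (intro prod.cong refl abs_of_pos)
  finally show "cmod (fps_nth zeros_fps n) \<le> a n"
    by (simp add: zeros_fps_def del: of_real_prod of_real_minus of_real_divide)
qed

text \<open>If \<open>c\<close> is no power of \<open>p\<close>, the functional equation propagates
  the zero \<open>1 / c\<close> to all \<open>p ^ n / c\<close>. These accumulate at 0, where the
  value is 1.\<close>

lemma zeros_fps_zero:
  assumes "c \<noteq> 0" "eval_fps zeros_fps (1 / c) = 0"
  shows "\<exists>k. c = of_real p ^ k"
proof (rule ccontr)
  assume nex: "\<not> ?thesis"
  note ent = fps_conv_radius_zeros_fps fps_conv_radius_scale_infty[OF fps_conv_radius_zeros_fps]
  have func: "eval_fps zeros_fps z = (1 - z) * eval_fps zeros_fps (of_real p * z)" for z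
    using arg_cong[OF zeros_fps_eq, of "\<lambda>f. eval_fps f z"]
    by (simp add: eval_fps_mult eval_fps_diff eval_fps_scale ent)
  have zeros: "eval_fps zeros_fps (of_real p ^ n * (1 / c)) = 0" for n
  proof (induction n)
    case 0 show ?case using assms by simp
  next
    case (Suc n)
    have "1 - of_real p ^ n * (1 / c) \<noteq> 0"
      using nex assms(1) by (auto simp: field_simps)
    then show ?case
      using Suc func[of "of_real p ^ n * (1 / c)"] assms(1) by (simp add: mult.assoc)
  qed
  have "fps_nth zeros_fps 0 = 0"
    by (rule fps_nth_0_eq_0_of_zeros[OF ent(1) _ zeros]) (use p in simp)
  then show False by simp
qed

lemma eigenvalue_cases:
  assumes "c \<in> eigenvalues_on_l2 \<pi> (right_mult kernel)" "c \<noteq> 0"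
  shows "\<exists>k. c = of_real p ^ k"
proof -
  obtain \<mu> where \<mu>: "\<mu> \<in> l2 \<pi>" "\<mu> \<noteq> (\<lambda>i. 0)" and eig: "right_mult kernel \<mu> = (\<lambda>i. c * \<mu> i)"
    using assms(1) unfolding eigenvalues_on_l2_def by blast
  have \<mu>0: "\<mu> 0 \<noteq> 0" by (rule eigenvector_0_ne_0[OF eig \<mu>(2)])
  define F where "F = Abs_fps \<mu>"
  have ent: "fps_conv_radius F = \<infinity>"
    unfolding F_def by (rule fps_conv_radius_l2[OF \<mu>(1)])
  \<comment> \<open>The division is formal; \<open>G\<close> need not be entire.\<close>
  define G where "G = F * inverse zeros_fps"
  have FG: "F = zeros_fps * G"
  proof -
    have "zeros_fps * G = F * (inverse zeros_fps * zeros_fps)" by (simp only: G_def mult_ac)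
    also have "\<dots> = F" by (simp only: inverse_mult_eq_1 zeros_fps_nth_0 zero_neq_one[symmetric] not_False_eq_True mult_1_right)
    finally show ?thesis ..
  qed
  let ?S = "fps_scale (complex_of_real p)" and ?y = "fps_const (complex_of_real y)" and ?p = "fps_const (complex_of_real p)"
  have N1: "(1 - fps_X) * ?S zeros_fps = zeros_fps"
    by (rule zeros_fps_eq[symmetric])
  \<comment> \<open>\<open>N1\<close> and \<open>N2\<close> absorb the polynomial factors in front
    of the dilations, so the equation for \<open>G\<close> becomes a first-order recursion.\<close>
  have N2: "(1 - fps_X) * (1 - ?p * fps_X) * ?S (?S zeros_fps) = zeros_fps"
  proof -
    have "?S zeros_fps = ?S ((1 - fps_X) * ?S zeros_fps)" by (simp only: N1)
    also have "\<dots> = (1 - ?p * fps_X) * ?S (?S zeros_fps)"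
      by (simp add: fps_scale_simps del: fps_scale_scale)
    finally show ?thesis using N1 by (simp only: mult.assoc)
  qed
  have "0 = (1 - fps_const c * fps_X) * F - (1 + ?y) * (1 - fps_X) * ?S F
      + ?y * (1 - fps_X) * (1 - ?p * fps_X) * ?S (?S F)"
    using eig eigen_iff[of F c] by (simp add: F_def del: fps_scale_scale)
  also have "\<dots> = (1 - fps_const c * fps_X) * (zeros_fps * G) - (1 + ?y) * ((1 - fps_X) * ?S zeros_fps) * ?S G
      + ?y * ((1 - fps_X) * (1 - ?p * fps_X) * ?S (?S zeros_fps)) * ?S (?S G)"
    unfolding FG fps_scale_mult by (simp only: mult.assoc)
  also have "\<dots> = zeros_fps * ((1 - fps_const c * fps_X) * G - (1 + ?y) * ?S G + ?y * ?S (?S G))"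
    unfolding N1 N2 by (simp add: algebra_simps del: fps_scale_scale)
  finally have "zeros_fps * ((1 - fps_const c * fps_X) * G - (1 + ?y) * ?S G + ?y * ?S (?S G)) = 0" ..
  moreover have "zeros_fps \<noteq> 0" by (metis fps_zero_nth zero_neq_one zeros_fps_nth_0)
  ultimately have G: "(1 - fps_const c * fps_X) * G - (1 + ?y) * ?S G + ?y * ?S (?S G) = 0"
    by simp
  have rec: "of_real ((1 - p ^ Suc n) * (1 - y * p ^ Suc n)) * fps_nth G (Suc n) = c * fps_nth G n" for n
  proof -
    have "fps_nth ((1 - fps_const c * fps_X) * G - (1 + ?y) * ?S G + ?y * ?S (?S G)) (Suc n) =
        of_real ((1 - p ^ Suc n) * (1 - y * p ^ Suc n)) * fps_nth G (Suc n) - c * fps_nth G n"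
      by (simp add: algebra_simps)
    then show ?thesis unfolding G by simp
  qed
  define \<gamma> where "\<gamma> = (\<lambda>n. \<Prod>j<n. 1 / ((1 - p ^ Suc j) * (1 - y * p ^ Suc j)))"
  have \<gamma>1: "1 \<le> \<gamma> n" for n
    unfolding \<gamma>_def by (rule prod_ge_1) (use l_Suc in \<open>simp only: le_divide_eq_1_pos\<close>)
  have \<gamma>Suc: "\<gamma> (Suc n) * ((1 - p ^ Suc n) * (1 - y * p ^ Suc n)) = \<gamma> n" for n
  proof -
    have "\<gamma> (Suc n) = \<gamma> n * (1 / ((1 - p ^ Suc n) * (1 - y * p ^ Suc n)))"
      unfolding \<gamma>_def by (rule prod.lessThan_Suc)
    moreover have nz: "(1 - p ^ Suc n) * (1 - y * p ^ Suc n) \<noteq> 0"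
      using l_Suc(1)[of n] by linarith
    ultimately show ?thesis
      by (simp only: mult.assoc[of "\<gamma> n"] times_divide_eq_left mult_1 divide_self[OF nz] mult_1_right)
  qed
  have g: "fps_nth G n = \<mu> 0 * c ^ n * of_real (\<gamma> n)" for n
  proof (induction n)
    case 0 show ?case by (simp add: G_def F_def \<gamma>_def)
  next
    case (Suc n)
    let ?l = "(1 - p ^ Suc n) * (1 - y * p ^ Suc n)"
    have "of_real ?l * fps_nth G (Suc n) = of_real ?l * (\<mu> 0 * c ^ Suc n * of_real (\<gamma> (Suc n)))"
      unfolding rec Suc \<gamma>Suc[of n, symmetric] by simp
    moreover have "complex_of_real ?l \<noteq> 0"
      unfolding of_real_eq_0_iff using l_Suc(1)[of n] by linarith
    ultimately show ?case by (rule mult_left_cancel[THEN iffD1, rotated])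
  qed
  \<comment> \<open>The death rates tend to 1, so the ratio of successive coefficients tends to
    \<open>c\<close> and \<open>1 / c\<close> lies on the boundary of the disc of
    convergence.\<close>
  have rad: "fps_conv_radius G = ereal (1 / cmod c)"
    unfolding fps_conv_radius_def
  proof (rule conv_radius_ratio_limit_nonzero[OF refl])
    show "1 / cmod c \<noteq> 0" using assms(2) by simp
    have "cmod (fps_nth G n) / cmod (fps_nth G (Suc n)) = (1 - p ^ Suc n) * (1 - y * p ^ Suc n) * (1 / cmod c)" for n
    proof -
      have "cmod (fps_nth G n) / cmod (fps_nth G (Suc n)) = \<gamma> n / \<gamma> (Suc n) * (1 / cmod c)"
        unfolding g using \<gamma>1[of n] \<gamma>1[of "Suc n"] \<mu>0 assms(2) by (simp add: norm_mult norm_power)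
      also have "\<gamma> n / \<gamma> (Suc n) = (1 - p ^ Suc n) * (1 - y * p ^ Suc n)"
        unfolding \<gamma>Suc[of n, symmetric] using \<gamma>1[of "Suc n"] by simp
      finally show ?thesis .
    qed
    moreover have "(\<lambda>n. (1 - p ^ Suc n) * (1 - y * p ^ Suc n) * (1 / cmod c)) \<longlonglongrightarrow> 1 * (1 / cmod c)"
      by (intro tendsto_mult l_Suc_tendsto tendsto_const)
    ultimately show "(\<lambda>n. cmod (fps_nth G n) / cmod (fps_nth G (Suc n))) \<longlonglongrightarrow> 1 / cmod c"
      by (simp only: mult_1)
  qed
  \<comment> \<open>On the ray towards \<open>1 / c\<close>, \<open>\<gamma> n \<ge> 1\<close>
    bounds the modulus of \<open>G\<close> below by \<open>cmod (\<mu> 0) / (1 - t)\<close>. Since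
    \<open>F\<close> is entire, letting \<open>t\<close> tend to 1 forces \<open>zeros_fps\<close>
    to vanish at \<open>1 / c\<close>.\<close>
  have bound: "cmod (eval_fps zeros_fps (of_real t / c)) * cmod (\<mu> 0) \<le> (1 - t) * cmod (eval_fps F (of_real t / c))"
    if t: "0 \<le> t" "t < 1" for t
  proof -
    have nz: "ereal (cmod (of_real t / c)) < fps_conv_radius G"
      using t assms(2) by (simp add: rad norm_divide divide_strict_right_mono)
    have gt: "fps_nth G n * (of_real t / c) ^ n = \<mu> 0 * of_real (\<gamma> n * t ^ n)" for n
      using assms(2) by (simp add: g power_divide)
    have "summable (\<lambda>n. cmod (\<mu> 0) * (\<gamma> n * t ^ n))"
      using norm_summable_fps[OF nz] t \<gamma>1 unfolding gt by (simp add: norm_mult norm_power order_trans[OF zero_le_one])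
    then have s: "summable (\<lambda>n. \<gamma> n * t ^ n)"
      using \<mu>0 by (simp add: summable_cmult_iff)
    have "eval_fps G (of_real t / c) = \<mu> 0 * of_real (\<Sum>n. \<gamma> n * t ^ n)"
    proof -
      have "(\<lambda>n. \<mu> 0 * complex_of_real (\<gamma> n * t ^ n)) sums (\<mu> 0 * of_real (\<Sum>n. \<gamma> n * t ^ n))"
        by (intro sums_mult sums_of_real summable_sums s)
      then show ?thesis
        unfolding eval_fps_def gt by (rule sums_unique[symmetric])
    qed
    then have "eval_fps F (of_real t / c) = eval_fps zeros_fps (of_real t / c) * (\<mu> 0 * of_real (\<Sum>n. \<gamma> n * t ^ n))"
      unfolding FG using nz by (simp add: eval_fps_mult fps_conv_radius_zeros_fps)
    then have e: "cmod (eval_fps F (of_real t / c)) =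
        cmod (eval_fps zeros_fps (of_real t / c)) * cmod (\<mu> 0) * \<bar>\<Sum>n. \<gamma> n * t ^ n\<bar>"
      by (simp add: norm_mult)
    have geo: "(\<lambda>n. t ^ n) sums (1 / (1 - t))"
      using t by (intro geometric_sums) simp
    have "1 / (1 - t) \<le> (\<Sum>n. \<gamma> n * t ^ n)"
      by (rule sums_le[OF _ geo summable_sums[OF s]]) (use t \<gamma>1 in \<open>simp add: mult_le_cancel_right1\<close>)
    then have "1 \<le> (1 - t) * (\<Sum>n. \<gamma> n * t ^ n)"
      using t by (simp add: pos_divide_le_eq mult.commute)
    also have "\<dots> \<le> (1 - t) * \<bar>\<Sum>n. \<gamma> n * t ^ n\<bar>"
      using t by (intro mult_left_mono) simp_all
    finally have "cmod (eval_fps zeros_fps (of_real t / c)) * cmod (\<mu> 0) * 1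
        \<le> cmod (eval_fps zeros_fps (of_real t / c)) * cmod (\<mu> 0) * ((1 - t) * \<bar>\<Sum>n. \<gamma> n * t ^ n\<bar>)"
      by (intro mult_left_mono) simp_all
    then show ?thesis by (simp add: e mult_ac)
  qed
  define t where "t = (\<lambda>n. 1 - 1 / real (Suc n))"
  have t: "0 \<le> t n" "t n < 1" for n by (simp_all add: t_def)
  have "(\<lambda>n. 1 - 1 / real (Suc n)) \<longlonglongrightarrow> 1 - 0"
    by (intro tendsto_diff tendsto_const LIMSEQ_Suc[OF lim_1_over_n])
  then have tlim: "t \<longlonglongrightarrow> 1" by (simp add: t_def)
  then have tc: "(\<lambda>n. of_real (t n) / c) \<longlonglongrightarrow> of_real 1 / c"
    using assms(2) by (intro tendsto_divide tendsto_of_real tendsto_const)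
  have cont: "isCont (eval_fps H) z" if "fps_conv_radius H = \<infinity>" for H :: "complex fps" and z
    using continuous_on_eval_fps[of H] that by (simp add: continuous_on_eq_continuous_at)
  have "cmod (eval_fps zeros_fps (of_real 1 / c)) * cmod (\<mu> 0) \<le> (1 - 1) * cmod (eval_fps F (of_real 1 / c))"
  proof (rule LIMSEQ_le)
    show "(\<lambda>n. cmod (eval_fps zeros_fps (of_real (t n) / c)) * cmod (\<mu> 0)) \<longlonglongrightarrow>
        cmod (eval_fps zeros_fps (of_real 1 / c)) * cmod (\<mu> 0)"
      by (intro tendsto_mult tendsto_norm tendsto_const isCont_tendsto_compose[OF cont tc] fps_conv_radius_zeros_fps)
    show "(\<lambda>n. (1 - t n) * cmod (eval_fps F (of_real (t n) / c))) \<longlonglongrightarrow> (1 - 1) * cmod (eval_fps F (of_real 1 / c))"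
      by (intro tendsto_mult tendsto_diff tendsto_norm tendsto_const tlim isCont_tendsto_compose[OF cont tc] ent)
    show "\<exists>N. \<forall>n\<ge>N. cmod (eval_fps zeros_fps (of_real (t n) / c)) * cmod (\<mu> 0)
        \<le> (1 - t n) * cmod (eval_fps F (of_real (t n) / c))"
      using bound[OF t] by blast
  qed
  then have "eval_fps zeros_fps (1 / c) = 0"
    using \<mu>0 by (simp add: mult_le_0_iff)
  with assms(2) show ?thesis by (rule zeros_fps_zero)
qed

text \<open>Write A for F(z) -> (1 - z) F(pz). For \<open>c = 0\<close> the equation factors as (1 -
  yA) (1 - A) F = 0, where 1 - yA is injective on series without constant term. So AF = F, the
  equation of \<open>zeros_fps\<close>.\<close>

lemma zero_not_eigenvalue:
  assumes yp: "y * p \<le> 1 / 2"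
  shows "0 \<notin> eigenvalues_on_l2 \<pi> (right_mult kernel)"
proof
  assume "0 \<in> eigenvalues_on_l2 \<pi> (right_mult kernel)"
  then obtain \<mu> where \<mu>: "\<mu> \<in> l2 \<pi>" "\<mu> \<noteq> (\<lambda>i. 0)" and eig: "right_mult kernel \<mu> = (\<lambda>i. 0 * \<mu> i)"
    unfolding eigenvalues_on_l2_def by blast
  define F where "F = Abs_fps \<mu>"
  let ?S = "fps_scale (complex_of_real p)" and ?y = "fps_const (complex_of_real y)" and ?p = "fps_const (complex_of_real p)"
  define H where "H = F - (1 - fps_X) * ?S F"
  have F: "F - (1 + ?y) * (1 - fps_X) * ?S F + ?y * (1 - fps_X) * (1 - ?p * fps_X) * ?S (?S F) = 0"
    using eig eigen_iff[of F 0] by (simp add: F_def del: fps_scale_scale)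
  have "H - ?y * ((1 - fps_X) * ?S H) =
      F - (1 + ?y) * (1 - fps_X) * ?S F + ?y * (1 - fps_X) * (1 - ?p * fps_X) * ?S (?S F)"
    by (simp add: H_def fps_scale_simps fps_const_mult[symmetric] algebra_simps del: fps_const_mult fps_scale_scale)
  then have HS: "H = ?y * ((1 - fps_X) * ?S H)"
    unfolding F by simp
  have "fps_nth H n = 0" for n
  proof (induction n)
    case 0 show ?case by (simp add: H_def)
  next
    case (Suc n)
    have "fps_nth H (Suc n) = of_real y * (of_real p ^ Suc n * fps_nth H (Suc n) - of_real p ^ n * fps_nth H n)"
      using arg_cong[OF HS, of "\<lambda>f. fps_nth f (Suc n)"] by (simp add: left_diff_distrib)
    then have "(1 - of_real y * of_real p ^ Suc n) * fps_nth H (Suc n) = 0"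
      using Suc by (simp add: left_diff_distrib)
    then show ?case using one_minus_power_ne_0[of n] by (simp del: power_Suc)
  qed
  then have FS: "F = (1 - fps_X) * ?S F"
    by (simp add: H_def fps_eq_iff)
  have rec: "of_real (1 - p ^ Suc n) * \<mu> (Suc n) = - (of_real (p ^ n) * \<mu> n)" for n
    using arg_cong[OF FS, of "\<lambda>f. fps_nth f (Suc n)"] by (simp add: left_diff_distrib F_def algebra_simps)
  have "\<mu> (id 0) = 0"
  proof (rule l2_eq_0_of_increasing[OF \<mu>(1)])
    show "strict_mono (id :: nat \<Rightarrow> nat)" by (simp add: strict_mono_def)
    fix m
    define b where "b = p ^ Suc m"
    have b: "0 < b" "b < 1" "y * b < 1" using power_Suc_p[of m] by (simp_all add: b_def)
    have "cmod (of_real (1 - b) * \<mu> (Suc m)) = cmod (- (of_real (p ^ m) * \<mu> m))"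
      unfolding b_def by (simp only: rec)
    then have "(1 - b) * cmod (\<mu> (Suc m)) = p ^ m * cmod (\<mu> m)"
      using b p by (simp add: norm_mult norm_power del: of_real_diff)
    then have eq: "cmod (\<mu> (Suc m)) = p ^ m / (1 - b) * cmod (\<mu> m)"
      using b by (simp add: field_simps)
    have pim: "\<pi> (Suc m) = \<pi> m * (y * p * (p ^ m)\<^sup>2 / ((1 - b) * (1 - y * b)))"
    proof -
      have nz: "(1 - b) * (1 - y * b) \<noteq> 0" using b by simp
      have "\<pi> m * (y * p * (p ^ m)\<^sup>2) = \<pi> (Suc m) * ((1 - b) * (1 - y * b))"
        using rev[of m] by (simp add: b_def power_mult[symmetric] mult_ac)
      then show ?thesis
        by (simp only: nonzero_eq_divide_eq[OF nz] times_divide_eq_right)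
    qed
    have "b \<le> p" using p by (simp add: b_def power_le_one)
    then have "y * b \<le> 1 / 2" using yp y by (meson less_imp_le mult_left_mono order_trans)
    \<comment> \<open>Both \<open>y * b\<close> and \<open>y * p * (1 - b)\<close> are at most 1/2,
      which is how the hypothesis on \<open>y * p\<close> yields the growth condition.\<close>
    moreover have "y * p * (1 - b) \<le> 1 / 2 * 1"
      using yp b y p by (intro mult_mono) simp_all
    ultimately have "y * p * (1 - b) \<le> 1 - y * b" by linarith
    then have "(cmod (\<mu> m))\<^sup>2 / \<pi> m \<le> (cmod (\<mu> (Suc m)))\<^sup>2 / \<pi> (Suc m)"
      unfolding eq pim using b p y pos[of m] by (intro weighted_square_step) simp_all
    then show "(cmod (\<mu> (id m)))\<^sup>2 / \<pi> (id m) \<le> (cmod (\<mu> (id (Suc m))))\<^sup>2 / \<pi> (id (Suc m))"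
      by simp
  qed
  then show False
    using eigenvector_0_ne_0[OF eig \<mu>(2)] by simp
qed

lemma eigenvalues_kernel:
  assumes "y * p \<le> 1 / 2"
  shows "eigenvalues_on_l2 \<pi> (right_mult kernel) = range (\<lambda>k. of_real p ^ k)"
proof (intro equalityI subsetI)
  fix c assume c: "c \<in> eigenvalues_on_l2 \<pi> (right_mult kernel)"
  then have "c \<noteq> 0" using zero_not_eigenvalue[OF assms] by blast
  with eigenvalue_cases[OF c] show "c \<in> range (\<lambda>k. of_real p ^ k)" by auto
next
  fix c :: complex assume "c \<in> range (\<lambda>k. of_real p ^ k)"
  then obtain k where k: "c = of_real p ^ k * of_real 1" by auto
  \<comment> \<open>The rows sum to 1, so \<open>r = 1\<close> makes \<open>\<pi>\<close> itself the
    starting eigenvector.\<close>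
  have "tame_eigenvalue (right_mult kernel) (of_real 1)"
    by (rule tame_eigenvalue_geometric[of _ _ 1]; (rule rev | simp add: algebra_simps))
  then show "c \<in> eigenvalues_on_l2 \<pi> (right_mult kernel)"
    unfolding k by (intro tame_eigenvalue_imp_eigenvalue tame_eigenvalue_power tame_eigenvalue_raise)
qed

end

subsection \<open>The four corank chains\<close>

lemma powi_minus_eq: "q powi (- int n) = (1 / q) ^ n" for q :: "'a::field"
  by (simp add: power_int_minus power_one_over inverse_eq_divide)

lemma powi_eqI: "m = - int n \<Longrightarrow> q powi m = (1 / q) ^ n" for q :: "'a::field"
  by (simp only: powi_minus_eq)

lemma eta_Suc: "eta (Suc k) q = eta k q * (1 - (1 / q) ^ Suc k)"
  unfolding eta_def by (subst prod.nat_ivl_Suc') (simp_all only: powi_minus_eq mult.commute le_add2 Suc_eq_plus1)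

lemma inverse_power_bounds:
  fixes q :: real
  assumes "1 < q"
  shows "0 < 1 / q" "1 / q < 1" "0 < (1 / q) ^ Suc n" "(1 / q) ^ Suc n < 1"
proof -
  show a: "0 < 1 / q" "1 / q < 1" using assms by simp_all
  then show "0 < (1 / q) ^ Suc n" by (intro zero_less_power)
  show "(1 / q) ^ Suc n < 1" using a by (intro power_Suc_less_one)
qed

lemma P_sym_eq_tridiag:
  assumes "q \<noteq> 0"
  shows "P_sym q = tridiag (\<lambda>i. (1 / q) * (1 / q) ^ i) (\<lambda>i. (1 - 1 / q) * (1 / q) ^ i) (\<lambda>i. 1 - (1 / q) ^ i)"
proof -
  have b: "q powi (- int i - 1) = (1 / q) * (1 / q) ^ i" for i
    by (subst powi_eqI[of _ "Suc i"]) simp_all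
  show ?thesis
    unfolding P_sym_def tridiag_def b powi_minus_eq by (intro ext) (simp only: left_diff_distrib mult_1)
qed

lemma P_Her_eq_tridiag:
  assumes "q \<noteq> 0"
  shows "P_Her q = tridiag (\<lambda>i. (1 / q) * ((1 / q)\<^sup>2) ^ i) (\<lambda>i. (1 - 1 / q) * ((1 / q)\<^sup>2) ^ i) (\<lambda>i. 1 - ((1 / q)\<^sup>2) ^ i)"
proof -
  have a: "q powi (- 2 * int i) = ((1 / q)\<^sup>2) ^ i" for i
    by (subst powi_eqI[of _ "2 * i"]) (simp_all add: power_mult)
  have b: "q powi (- 2 * int i - 1) = (1 / q) * ((1 / q)\<^sup>2) ^ i" for i
    by (subst powi_eqI[of _ "1 + 2 * i"]) (simp, simp only: power_add power_mult power_one_right)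
  have c: "q powi (- 1) = 1 / q"
    using powi_minus_eq[of q 1] by simp
  show ?thesis
    unfolding P_Her_def tridiag_def a b c by (intro ext) (simp only: mult.commute)
qed

lemma P_alt_eq_tridiag:
  assumes "q \<noteq> 0"
  defines "p \<equiv> (1 / q)\<^sup>2"
  shows "P_alt q = tridiag (\<lambda>i. (1 / q) * p ^ (2 * i + 1))
    (\<lambda>i. 1 - (1 / q) * p ^ (2 * i + 1) - (1 - p ^ i) * (1 - (1 / q) * p ^ i)) (\<lambda>i. (1 - p ^ i) * (1 - (1 / q) * p ^ i))"
proof -
  have a: "q powi (- 2 * int i) = p ^ i" for i
    by (subst powi_eqI[of _ "2 * i"]) (simp_all add: power_mult p_def)
  have b: "q powi (- 2 * int i - 1) = (1 / q) * p ^ i" for i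
    by (subst powi_eqI[of _ "1 + 2 * i"]) (simp, simp only: power_add power_mult power_one_right p_def)
  have c: "q powi (- 4 * int i - 3) = (1 / q) * p ^ (2 * i + 1)" for i
    by (subst powi_eqI[of _ "1 + 2 * (2 * i + 1)"])
       (simp, simp only: power_add[of _ 1] power_mult[of _ 2] power_one_right p_def)
  show ?thesis
    unfolding P_alt_def tridiag_def a b c ..
qed

lemma Q_alt_eq_tridiag:
  assumes "q \<noteq> 0"
  defines "p \<equiv> (1 / q)\<^sup>2"
  shows "Q_alt q = tridiag (\<lambda>i. q * p ^ (2 * i + 1))
    (\<lambda>i. 1 - q * p ^ (2 * i + 1) - (1 - p ^ i) * (1 - q * p ^ i)) (\<lambda>i. (1 - p ^ i) * (1 - q * p ^ i))"
proof -
  have a: "q powi (- 2 * int i) = p ^ i" for i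
    by (subst powi_eqI[of _ "2 * i"]) (simp_all add: power_mult p_def)
  have b: "q powi (- 2 * int i + 1) = q * p ^ i" for i
  proof -
    have "q powi (- 2 * int i + 1) = q powi (- 2 * int i) * q powi 1"
      using assms(1) by (intro power_int_add) simp
    then show ?thesis
      unfolding a power_int_1_right by (rule trans[OF _ mult.commute])
  qed
  have c: "q powi (- 4 * int i - 1) = q * p ^ (2 * i + 1)" for i
  proof -
    have "- 4 * int i - 1 = - 2 * int (2 * i + 1) + 1" by simp
    then show ?thesis by (simp only: b)
  qed
  show ?thesis
    unfolding Q_alt_def tridiag_def a b c ..
qed

section \<open>Detailed balance for the four stationary distributions\<close>

lemma linear_kernel_sym:
  assumes "1 < q"
  shows "linear_kernel (pi_sym q) (1 / q) (1 / q)"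
proof
  show "0 < pi_sym q i" for i using pi_sym_pos[OF assms] .
  fix i
  have "1 < q ^ Suc i" using assms by (rule one_less_power) simp
  then have nz: "q ^ Suc i - 1 \<noteq> 0" by linarith
  have "pi_sym q (Suc i) = pi_sym q i / (q ^ Suc i - 1)"
    unfolding pi_sym_def by (subst prod.nat_ivl_Suc') (simp_all add: mult.commute del: power_Suc)
  moreover have "1 - (1 / q) ^ Suc i = (q ^ Suc i - 1) * (1 / q) ^ Suc i"
    using assms by (simp add: left_diff_distrib power_one_over diff_divide_distrib del: power_Suc)
  ultimately show "pi_sym q i * (1 / q * (1 / q) ^ i) = pi_sym q (Suc i) * (1 - (1 / q) ^ Suc i)"
    using nz by (simp del: power_Suc add: power_Suc[symmetric])
qed (use inverse_power_bounds(1,2)[OF assms] in simp_all)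

lemma linear_kernel_Her:
  assumes "1 < q"
  shows "linear_kernel (pi_Her q) (1 / q) ((1 / q)\<^sup>2)"
proof
  show "0 < pi_Her q i" for i using pi_Her_pos[OF assms] .
  show "0 < (1 / q)\<^sup>2" "(1 / q)\<^sup>2 < 1"
    using inverse_power_bounds(3,4)[OF assms, of 1] by (simp_all only: numeral_2_eq_2 One_nat_def)
  fix i
  have q2: "1 < q\<^sup>2" using assms by (rule one_less_power) simp
  define L where "L = 1 - ((1 / q)\<^sup>2) ^ Suc i"
  have L: "L \<noteq> 0"
    using inverse_power_bounds(4)[OF q2, of i] unfolding L_def power_one_over[of q 2] by linarith
  have e: "eta (Suc i) (q\<^sup>2) = eta i (q\<^sup>2) * L"
    unfolding eta_Suc L_def by (simp add: power_divide)
  have s: "q ^ ((Suc i)\<^sup>2) = q ^ (i\<^sup>2) * (q * (q\<^sup>2) ^ i)"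
  proof -
    have "(Suc i)\<^sup>2 = i\<^sup>2 + (1 + 2 * i)" by (simp add: power2_eq_square)
    then show ?thesis by (simp only: power_add power_mult power_one_right)
  qed
  have "pi_Her q (Suc i) = pi_Her q i * (1 / q * ((1 / q)\<^sup>2) ^ i) / L"
    unfolding pi_Her_def e s by (simp add: power_one_over power_divide)
  then show "pi_Her q i * (1 / q * ((1 / q)\<^sup>2) ^ i) = pi_Her q (Suc i) * (1 - ((1 / q)\<^sup>2) ^ Suc i)"
    unfolding L_def[symmetric] using L by simp
qed (use inverse_power_bounds(1,2)[OF assms] in simp_all)

lemma quadratic_kernel_alt:
  assumes "1 < q"
  shows "quadratic_kernel (pi_alt q) (1 / q) ((1 / q)\<^sup>2)"
proof
  show "0 < pi_alt q i" for i using pi_alt_pos[OF assms] .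
  show "0 < (1 / q)\<^sup>2" "(1 / q)\<^sup>2 < 1"
    using inverse_power_bounds(3,4)[OF assms, of 1] by (simp_all only: numeral_2_eq_2 One_nat_def)
  show "1 / q * (1 / q)\<^sup>2 < 1"
    using inverse_power_bounds(4)[OF assms, of 2] by (simp only: power_Suc)
  fix i
  define p where "p = (1 / q)\<^sup>2"
  define L where "L = (1 - p ^ Suc i) * (1 - 1 / q * p ^ Suc i)"
  have p1: "p ^ Suc i = (1 / q) ^ Suc (2 * i + 1)"
    unfolding p_def power_mult[symmetric] by simp
  then have p2: "1 / q * p ^ Suc i = (1 / q) ^ Suc (Suc (2 * i + 1))"
    by (simp only: power_Suc)
  have L: "L \<noteq> 0"
    unfolding L_def p2 unfolding p1 using inverse_power_bounds(4)[OF assms] by (simp add: less_imp_neq del: power_Suc)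
  \<comment> \<open>The index of \<open>eta\<close> grows by two, and the new factors, with
    exponents \<open>2 * i + 2\<close> and \<open>2 * i + 3\<close>, are the two factors of
    \<open>L\<close>.\<close>
  have e: "eta (2 * Suc i + 1) q = eta (2 * i + 1) q * L"
  proof -
    have "2 * Suc i + 1 = Suc (Suc (2 * i + 1))" by simp
    then show ?thesis by (simp only: eta_Suc L_def p2[symmetric]) (simp only: p1 mult.assoc)
  qed
  have s: "q ^ (2 * (Suc i)\<^sup>2 + Suc i) = q ^ (2 * i\<^sup>2 + i) * (q * (q\<^sup>2) ^ (2 * i + 1))"
  proof -
    have "2 * (Suc i)\<^sup>2 + Suc i = (2 * i\<^sup>2 + i) + (1 + 2 * (2 * i + 1))" by (simp add: power2_eq_square)
    then show ?thesis by (simp only: power_add power_mult power_one_right)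
  qed
  have "pi_alt q (Suc i) = pi_alt q i * (1 / q * p ^ (2 * i + 1)) / L"
    unfolding pi_alt_def e s by (simp add: p_def power_one_over power_divide)
  then show "pi_alt q i * (1 / q * ((1 / q)\<^sup>2) ^ (2 * i + 1)) =
      pi_alt q (Suc i) * ((1 - ((1 / q)\<^sup>2) ^ Suc i) * (1 - 1 / q * ((1 / q)\<^sup>2) ^ Suc i))"
    unfolding p_def[symmetric] L_def[symmetric] using L by simp
qed (use inverse_power_bounds(1,2)[OF assms] in simp_all)

lemma quadratic_kernel_alt':
  assumes "1 < q"
  shows "quadratic_kernel (pi'_alt q) q ((1 / q)\<^sup>2)"
proof
  show "0 < pi'_alt q i" for i using pi'_alt_pos[OF assms] .
  show "0 < (1 / q)\<^sup>2" "(1 / q)\<^sup>2 < 1"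
    using inverse_power_bounds(3,4)[OF assms, of 1] by (simp_all only: numeral_2_eq_2 One_nat_def)
  show "q * (1 / q)\<^sup>2 < 1" using assms by (simp add: power2_eq_square)
  show "0 < q" using assms by simp
  fix i
  define p where "p = (1 / q)\<^sup>2"
  define L where "L = (1 - p ^ Suc i) * (1 - q * p ^ Suc i)"
  have p1: "p ^ Suc i = (1 / q) ^ Suc (Suc (2 * i))"
    unfolding p_def power_mult[symmetric] by simp
  then have p2: "q * p ^ Suc i = (1 / q) ^ Suc (2 * i)"
    using assms by simp
  have L: "L \<noteq> 0"
    unfolding L_def p2 unfolding p1 using inverse_power_bounds(4)[OF assms] by (simp add: less_imp_neq del: power_Suc)
  have e: "eta (2 * Suc i) q = eta (2 * i) q * L"
  proof -
    have "2 * Suc i = Suc (Suc (2 * i))" by simp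
    then show ?thesis by (simp only: eta_Suc L_def p2) (simp only: p1 mult_ac)
  qed
  \<comment> \<open>The exponent grows by \<open>4 * i + 1 = 2 * (2 * i + 1) - 1\<close>, hence the
    division by \<open>q\<close>.\<close>
  have s: "q powi (2 * (int (Suc i))\<^sup>2 - int (Suc i)) = q powi (2 * (int i)\<^sup>2 - int i) * ((q\<^sup>2) ^ (2 * i + 1) / q)"
  proof -
    have e1: "2 * (int (Suc i))\<^sup>2 - int (Suc i) = (2 * (int i)\<^sup>2 - int i) + (int (2 * (2 * i + 1)) - 1)"
      by (simp add: power2_eq_square algebra_simps)
    have e2: "q powi (int (2 * (2 * i + 1)) - 1) = (q\<^sup>2) ^ (2 * i + 1) / q"
    proof -
      have "q powi (int (2 * (2 * i + 1)) - 1) = q powi int (2 * (2 * i + 1)) / q powi 1"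
        using assms by (intro power_int_diff) simp
      then show ?thesis by (simp only: power_int_of_nat power_int_1_right power_mult)
    qed
    show ?thesis
      unfolding e1 e2[symmetric] by (rule power_int_add) (use assms in simp)
  qed
  have "pi'_alt q (Suc i) = pi'_alt q i * (q * p ^ (2 * i + 1)) / L"
    unfolding pi'_alt_def e s using assms by (simp add: p_def power_one_over power_divide)
  then show "pi'_alt q i * (q * ((1 / q)\<^sup>2) ^ (2 * i + 1)) =
      pi'_alt q (Suc i) * ((1 - ((1 / q)\<^sup>2) ^ Suc i) * (1 - q * ((1 / q)\<^sup>2) ^ Suc i))"
    unfolding p_def[symmetric] L_def[symmetric] using L by simp
qed

text \<open>The second family consists of \<open>- (X ^ Suc k)\<close> with
  \<open>X = 1 / q\<close>, so of all the signed powers only \<open>- (X ^ 0) = - 1\<close> is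
  missing; \<open>n1\<close> and \<open>n2\<close> show that it is not reached otherwise.\<close>

lemma sym_spectrum_set:
  fixes q :: real
  assumes "1 < q"
  shows "range (\<lambda>k. complex_of_real (1 / q) ^ k) \<union> range (\<lambda>k. - complex_of_real (1 / q) * of_real (1 / q) ^ k) =
    (\<Union>k::nat. {of_real q powi (- int k), - (of_real q powi (- int k))}) - {- 1}"
proof -
  define X where "X = complex_of_real (1 / q)"
  have X: "of_real q powi (- int k) = X ^ k" for k
    by (simp add: powi_minus_eq X_def)
  have n1: "X ^ k \<noteq> - 1" for k
  proof
    assume "X ^ k = - 1"
    then have "complex_of_real ((1 / q) ^ k) = of_real (- 1)" by (simp add: X_def)
    then have "(1 / q) ^ k = - 1" by (simp only: of_real_eq_iff)
    moreover have "0 < (1 / q) ^ k" using assms by simp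
    ultimately show False by linarith
  qed
  have n2: "X * X ^ k \<noteq> 1" for k
  proof
    assume "X * X ^ k = 1"
    then have "complex_of_real ((1 / q) ^ Suc k) = of_real 1" by (simp add: X_def)
    then have "(1 / q) ^ Suc k = 1" by (simp only: of_real_eq_iff)
    then show False using inverse_power_bounds(4)[OF assms, of k] by linarith
  qed
  have "range (\<lambda>k. X ^ k) \<union> range (\<lambda>k. - X * X ^ k) = (\<Union>k::nat. {X ^ k, - (X ^ k)}) - {- 1}" (is "?A = ?B")
  proof (intro equalityI subsetI)
    fix c assume "c \<in> ?A"
    then consider k where "c = X ^ k" | k where "c = - (X ^ Suc k)" by auto
    then show "c \<in> ?B"
    proof cases
      case 1 then show ?thesis using n1 by auto
    next
      case 2 
      have "c \<noteq> - 1" using n2[of k] by (simp add: 2)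
      then show ?thesis unfolding 2 by blast
    qed
  next
    fix c assume "c \<in> ?B"
    then consider k where "c = X ^ k" | k where "c = - (X ^ k)" "c \<noteq> - 1" by blast
    then show "c \<in> ?A"
    proof cases
      case (2 k)
      then obtain m where "k = Suc m" by (cases k) auto
      then show ?thesis using 2 by auto
    qed auto
  qed
  then show ?thesis unfolding X X_def .
qed

text \<open>The two families are the even and the odd powers of \<open>- 1 / q\<close>.\<close>

lemma Her_spectrum_set:
  "range (\<lambda>k. complex_of_real ((1 / q)\<^sup>2) ^ k) \<union> range (\<lambda>k. - complex_of_real (1 / q) * of_real ((1 / q)\<^sup>2) ^ k) =
    {(- of_real q) powi (- int k) |k::nat. True}"
proof -
  define X where "X = complex_of_real (1 / q)"
  have X: "(- of_real q) powi (- int k) = (- X) ^ k" for k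
    by (simp add: powi_minus_eq X_def)
  have even: "(- X) ^ (2 * k) = (X\<^sup>2) ^ k" for k
    by (simp add: power_mult)
  then have odd: "(- X) ^ (2 * k + 1) = - X * (X\<^sup>2) ^ k" for k
    by simp
  have "range (\<lambda>k. (X\<^sup>2) ^ k) \<union> range (\<lambda>k. - X * (X\<^sup>2) ^ k) = {(- X) ^ k |k. True}" (is "?A = ?B")
  proof (intro equalityI subsetI)
    fix c assume "c \<in> ?A"
    then consider k where "c = (- X) ^ (2 * k)" | k where "c = (- X) ^ (2 * k + 1)"
      unfolding even odd by blast
    then show "c \<in> ?B"
      by cases blast+
  next
    fix c assume "c \<in> ?B"
    then obtain k where k: "c = (- X) ^ k" by blast
    show "c \<in> ?A"
    proof (cases "even k")
      case True
      then obtain m where "k = 2 * m" by (elim evenE)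
      then show ?thesis unfolding k using even[of m] by blast
    next
      case False
      then obtain m where "k = 2 * m + 1" by (elim oddE)
      then show ?thesis unfolding k using odd[of m] by blast
    qed
  qed
  then show ?thesis unfolding X X_def of_real_power .
qed

lemma alt_spectrum_set:
  "range (\<lambda>k. complex_of_real ((1 / q)\<^sup>2) ^ k) = {of_real q powi (- 2 * int k) |k::nat. True}"
proof -
  have "of_real q powi (- 2 * int k) = complex_of_real ((1 / q)\<^sup>2) ^ k" for k
    using powi_minus_eq[of "complex_of_real q" "2 * k"] by (simp add: power_mult)
  then show ?thesis by auto
qed

theorem theorem8:
  fixes q :: nat
  assumes "primepow q"
  shows
    "(compact_operator_on_l2 (pi_sym q) (right_mult (P_sym q)) \<and>
      eigenvalues_on_l2 (pi_sym q) (right_mult (P_sym q)) =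
        (\<Union>k::nat. {of_nat q powi (- int k), - (of_nat q powi (- int k))}) - {- 1}) \<and>
     (compact_operator_on_l2 (pi_alt q) (right_mult (P_alt q)) \<and>
      eigenvalues_on_l2 (pi_alt q) (right_mult (P_alt q)) =
        {of_nat q powi (- 2 * int k) |k::nat. True} \<and>
      compact_operator_on_l2 (pi'_alt q) (right_mult (Q_alt q)) \<and>
      eigenvalues_on_l2 (pi'_alt q) (right_mult (Q_alt q)) =
        {of_nat q powi (- 2 * int k) |k::nat. True}) \<and>
     ((\<exists>p m::nat. prime p \<and> odd p \<and> m > 0 \<and> q = p ^ m) \<longrightarrow>
      compact_operator_on_l2 (pi_Her q) (right_mult (P_Her q)) \<and>
      eigenvalues_on_l2 (pi_Her q) (right_mult (P_Her q)) =
        {(- of_nat q) powi (- int k) |k::nat. True})"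
proof -
  have "q > 1" using assms by (rule primepow_gt_Suc_0[unfolded One_nat_def[symmetric]])
  then have q: "real q > 1" "real q \<noteq> 0" "real q \<ge> 2" by simp_all
  interpret sym: linear_kernel "pi_sym q" "1 / q" "1 / q"
    by (rule linear_kernel_sym[OF q(1)])
  interpret alt: quadratic_kernel "pi_alt q" "1 / q" "(1 / q)\<^sup>2"
    by (rule quadratic_kernel_alt[OF q(1)])
  interpret alt': quadratic_kernel "pi'_alt q" q "(1 / q)\<^sup>2"
    by (rule quadratic_kernel_alt'[OF q(1)])
  interpret Her: linear_kernel "pi_Her q" "1 / q" "(1 / q)\<^sup>2"
    by (rule linear_kernel_Her[OF q(1)])
  have half: "1 / q \<le> 1 / 2" using q by (simp add: field_simps)
  \<comment> \<open>\<open>y * p\<close> is \<open>1 / q ^ 3\<close> for \<open>P_alt\<close> and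
    \<open>1 / q\<close> for \<open>Q_alt\<close>, so \<open>q \<ge> 2\<close> suffices for
    both.\<close>
  have "1 / q * (1 / real q)\<^sup>2 \<le> 1 / 2 * 1"
    using half q by (intro mult_mono power_le_one) simp_all
  then have y1: "1 / q * (1 / real q)\<^sup>2 \<le> 1 / 2" by simp
  have y2: "q * (1 / real q)\<^sup>2 \<le> 1 / 2"
    using half q by (simp add: power2_eq_square)
  have H: "compact_operator_on_l2 (pi_Her q) (right_mult (P_Her q)) \<and>
      eigenvalues_on_l2 (pi_Her q) (right_mult (P_Her q)) = {(- of_nat q) powi (- int k) |k::nat. True}"
    if ex: "\<exists>p m::nat. prime p \<and> odd p \<and> m > 0 \<and> q = p ^ m"
  proof -
    \<comment> \<open>Oddness excludes \<open>q = 2\<close> and provides the bound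
      \<open>1 / q \<le> 1 / 3\<close> of \<open>zero_not_eigenvalue_quadratic\<close>.\<close>
    have "odd q" using ex by auto
    then have "q \<noteq> 2" by auto
    then have "3 \<le> q" using \<open>q > 1\<close> by linarith
    then have "1 / q \<le> 1 / 3" by (simp add: field_simps)
    then have "0 \<notin> eigenvalues_on_l2 (pi_Her q) (right_mult Her.kernel)"
      by (rule Her.zero_not_eigenvalue_quadratic[OF refl])
    from Her.eigenvalues_kernel[OF this] Her.compact_kernel show ?thesis
      unfolding P_Her_eq_tridiag[OF q(2)] Her_spectrum_set by simp
  qed
  show ?thesis
    using sym.compact_kernel sym.eigenvalues_kernel[OF sym.zero_not_eigenvalue_linear[OF refl]]
      alt.compact_kernel alt.eigenvalues_kernel[OF y1] alt'.compact_kernel alt'.eigenvalues_kernel[OF y2] H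
    unfolding P_sym_eq_tridiag[OF q(2)] P_alt_eq_tridiag[OF q(2)] Q_alt_eq_tridiag[OF q(2)]
      sym_spectrum_set[OF q(1)] alt_spectrum_set of_real_of_nat_eq
    by blast
qed

end
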